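(* Let $X\in\mathbb{R}^{m\times n}$ with $\operatorname{rank}(X)=r\le d$, let $M\ge 2$ be an integer, and let $0<p\le 1$ and $p_1,\dots,p_M>0$ satisfy $\sum_{i=1}^{M}1/p_i=1/p$. Consider factorizations $X=U_1U_2\cdots U_M$ with $U_1\in\mathbb{R}^{m\times d}$, $U_i\in\mathbb{R}^{d\times d}$ for $1<i<M$, and $U_M\in\mathbb{R}^{d\times n}$. Then, with minima over all such factorizations (and attained), \[ \|X\|_{S_p}=\min_{X=\prod_{i=1}^{M}U_i}\prod_{i=1}^{M}\|U_i\|_{S_{p_i}} =\min_{X=\prod_{i=1}^{M}U_i}\left(\frac{\sum_{i=1}^{M}\|U_i\|_{S_{p_i}}^{p_i}/p_i}{1/p}\right)^{1/p}. \]
   Context: For $0<q<\infty$ and a real matrix $Y$ with singular values $\sigma_1(Y),\dots,\sigma_k(Y)$ ($k$ the smaller dimension of $Y$), the Schatten-$q$ (quasi-)norm is $\|Y\|_{S_q}=\left(\sum_{i=1}^{k}\sigma_i(Y)^q\right)^{1/q}$. *)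

theory Defs
  imports "Jordan_Normal_Form.DL_Rank" "Jordan_Normal_Form.Char_Poly"
    "HOL-Computational_Algebra.Polynomial"
begin

text \<open>Singular values of a real matrix Y (k = min of its dimensions many, with
multiplicity): the square roots of the eigenvalues (roots of the characteristic
polynomial, with multiplicity) of the k x k Gram matrix (Y^T Y or Y Y^T).\<close>

definition gram_mat :: "real mat \<Rightarrow> real mat" where
  "gram_mat Y = (if dim_col Y \<le> dim_row Y then transpose_mat Y * Y else Y * transpose_mat Y)"

definition singular_values :: "real mat \<Rightarrow> real multiset" where
  "singular_values Y = image_mset sqrt (proots (char_poly (gram_mat Y)))"

definition schatten :: "real \<Rightarrow> real mat \<Rightarrow> real" where
  "schatten q Y = (\<Sum>\<sigma>\<in>#singular_values Y. \<sigma> powr q) powr (1 / q)"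

fun mat_list_prod :: "real mat list \<Rightarrow> real mat" where
  "mat_list_prod [] = undefined"
| "mat_list_prod [A] = A"
| "mat_list_prod (A # B # As) = A * mat_list_prod (B # As)"

definition factorization :: "nat \<Rightarrow> nat \<Rightarrow> nat \<Rightarrow> nat \<Rightarrow> real mat \<Rightarrow> real mat list \<Rightarrow> bool" where
  "factorization m n d M X Us \<longleftrightarrow>
     length Us = M \<and> Us ! 0 \<in> carrier_mat m d \<and> Us ! (M - 1) \<in> carrier_mat d n \<and>
     (\<forall>i. 0 < i \<and> i < M - 1 \<longrightarrow> Us ! i \<in> carrier_mat d d) \<and>
     mat_list_prod Us = X"

end

theory Submission
  imports Defs "HOL-Computational_Algebra.Fundamental_Theorem_Algebra" "HOL-Combinatorics.Permutations"
begin

text \<open>The lower bound rests on Horn's inequality: for every \<open>k\<close>, the product of the \<open>k\<close> largest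
  singular values of \<open>U\<^sub>1 \<cdots> U\<^sub>M\<close> is at most the product over \<open>i\<close> of the same quantities for \<open>U\<^sub>i\<close>.
  It follows by applying the factors one at a time to a matrix \<open>W\<close> with \<open>k\<close> columns, since
  \<open>det ((Y W)\<^sup>T (Y W)) \<le> det (W\<^sup>T W) \<sigma>\<^sub>1(Y)\<^sup>2 \<cdots> \<sigma>\<^sub>k(Y)\<^sup>2\<close> by Cauchy interlacing. Weak log-majorization
  turns this into an inequality between sums of \<open>p\<close>-th powers, and Hoelder's inequality with the
  weights \<open>p / p\<^sub>i\<close> separates the factors; the weighted AM-GM inequality compares the product with the
  power mean. For attainment, distribute each singular value \<open>\<sigma>\<close> of \<open>X\<close> over the factors of a
  singular value decomposition as the powers \<open>\<sigma>\<close> to the \<open>p / p\<^sub>i\<close>, which makes all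
  \<open>\<parallel>U\<^sub>i\<parallel>\<close> to the \<open>p\<^sub>i\<close> equal.\<close>

section \<open>Majorization and Hoelder's inequality\<close>

text \<open>Abel summation as an induction: the partial sum up to \<open>k\<close> is nonnegative,
  so lowering its weight from \<open>w k\<close> to \<open>w (Suc k)\<close> only decreases the left
  side, while the new term carries the weight \<open>w (Suc k)\<close> on both sides.\<close>

lemma sum_antimono_weights_ge:
  fixes w x :: "nat \<Rightarrow> real"
  assumes "\<And>i j. i \<le> j \<Longrightarrow> j < n \<Longrightarrow> w j \<le> w i"
    and "\<And>k. k \<le> n \<Longrightarrow> 0 \<le> (\<Sum>i<k. x i)"
    and "k < n"
  shows "w k * (\<Sum>i<Suc k. x i) \<le> (\<Sum>i<Suc k. w i * x i)"
  using \<open>k < n\<close>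
proof (induction k)
  case 0
  then show ?case by simp
next
  case (Suc k)
  have "w (Suc k) * (\<Sum>i<Suc k. x i) \<le> w k * (\<Sum>i<Suc k. x i)"
    using Suc.prems assms(1)[of k "Suc k"] assms(2)[of "Suc k"]
    by (intro mult_right_mono) auto
  also have "\<dots> \<le> (\<Sum>i<Suc k. w i * x i)" using Suc by simp
  finally show ?case by (simp add: algebra_simps)
qed

lemma sum_antimono_weights_nonneg:
  fixes w x :: "nat \<Rightarrow> real"
  assumes "\<And>i j. i \<le> j \<Longrightarrow> j < n \<Longrightarrow> w j \<le> w i"
    and "\<And>i. i < n \<Longrightarrow> 0 \<le> w i"
    and "\<And>k. k \<le> n \<Longrightarrow> 0 \<le> (\<Sum>i<k. x i)"
  shows "0 \<le> (\<Sum>i<n. w i * x i)"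
proof (cases n)
  case (Suc k)
  have "0 \<le> w k * (\<Sum>i<Suc k. x i)" using assms(2)[of k] assms(3)[of n] Suc by simp
  also have "\<dots> \<le> (\<Sum>i<Suc k. w i * x i)"
    by (rule sum_antimono_weights_ge[of n]) (use assms Suc in auto)
  finally show ?thesis using Suc by simp
qed simp

text \<open>Sum \<open>b\<^sup>p - a\<^sup>p \<ge> p a\<^sup>p (ln b - ln a)\<close>; the right-hand side is nonnegative by Abel summation
  because the weights \<open>p a\<^sup>p\<close> decrease.\<close>

lemma sum_powr_le_if_prods_le_pos:
  fixes a b :: "nat \<Rightarrow> real"
  assumes "0 < p" and "\<And>i. i < n \<Longrightarrow> 0 < a i" and "\<And>i. i < n \<Longrightarrow> 0 < b i"
    and anti: "\<And>i j. i \<le> j \<Longrightarrow> j < n \<Longrightarrow> a j \<le> a i"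
    and prods: "\<And>k. k \<le> n \<Longrightarrow> (\<Prod>i<k. a i) \<le> (\<Prod>i<k. b i)"
  shows "(\<Sum>i<n. a i powr p) \<le> (\<Sum>i<n. b i powr p)"
proof -
  have "0 \<le> (\<Sum>i<n. (p * a i powr p) * (ln (b i) - ln (a i)))"
  proof (rule sum_antimono_weights_nonneg)
    fix k assume k: "k \<le> n"
    have "ln (\<Prod>i<k. a i) \<le> ln (\<Prod>i<k. b i)"
      by (rule ln_mono[OF prods[OF k]]) (use assms k in \<open>auto intro!: prod_pos\<close>)
    then show "0 \<le> (\<Sum>i<k. ln (b i) - ln (a i))"
      using less_imp_neq[OF assms(2)] less_imp_neq[OF assms(3)] k
      by (subst (asm) (1 2) ln_prod) (force simp: sum_subtractf)+
  next
    fix i j assume "i \<le> j" "j < n"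
    then show "p * a j powr p \<le> p * a i powr p"
      using assms by (intro mult_left_mono powr_mono2) (auto intro: less_imp_le)
  qed (use \<open>0 < p\<close> in auto)
  also have "\<dots> \<le> (\<Sum>i<n. b i powr p - a i powr p)"
  proof (rule sum_mono)
    fix i assume "i \<in> {..<n}"
    then have a: "0 < a i" and b: "0 < b i" using assms by auto
    \<comment> \<open>The tangent bound \<open>1 + x \<le> exp x\<close> at
      \<open>x = p * (ln (b i) - ln (a i))\<close>; for this \<open>x\<close>,
      \<open>a i powr p * exp x\<close> is exactly \<open>b i powr p\<close>.\<close>
    have "a i powr p * (1 + p * (ln (b i) - ln (a i))) \<le> a i powr p * exp (p * (ln (b i) - ln (a i)))"
      by (intro mult_left_mono exp_ge_add_one_self) auto
    also have "\<dots> = b i powr p"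
      using a b by (simp add: powr_def exp_add[symmetric] algebra_simps)
    finally show "p * a i powr p * (ln (b i) - ln (a i)) \<le> b i powr p - a i powr p"
      by (simp add: algebra_simps)
  qed
  finally show ?thesis by (simp add: sum_subtractf)
qed

text \<open>Zeros are reduced to the positive case. If \<open>a n = 0\<close>, the left sum gains
  only \<open>0 powr p = 0\<close>. Otherwise monotonicity makes all earlier \<open>a i\<close>
  positive, and the bound on the full product then keeps every \<open>b i\<close> away from
  zero.\<close>

lemma sum_powr_le_if_prods_le:
  fixes a b :: "nat \<Rightarrow> real"
  assumes "0 < p" and a: "\<And>i. 0 \<le> a i" and b: "\<And>i. 0 \<le> b i"
    and anti: "\<And>i j. i \<le> j \<Longrightarrow> a j \<le> a i"
    and prods: "\<And>k. (\<Prod>i<k. a i) \<le> (\<Prod>i<k. b i)"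
  shows "(\<Sum>i<n. a i powr p) \<le> (\<Sum>i<n. b i powr p)"
proof (induction n)
  case (Suc n)
  show ?case
  proof (cases "a n = 0")
    case True
    with Suc show ?thesis by (simp add: add_increasing2)
  next
    case False
    then have pos: "0 < a i" if "i < Suc n" for i
      using that anti[of i n] a[of n] by (simp add: order.strict_trans2)
    have "0 < (\<Prod>i<Suc n. a i)" using pos by (intro prod_pos) auto
    then have "(\<Prod>i<Suc n. b i) \<noteq> 0" using prods[of "Suc n"] by linarith
    then have "0 < b i" if "i < Suc n" for i
      using that b[of i] by (auto simp: less_le)
    with pos show ?thesis
      using \<open>0 < p\<close> anti prods by (intro sum_powr_le_if_prods_le_pos) auto
  qed
qed simp

section \<open>Weighted AM-GM and Hoelder's inequality for several factors\<close>

text \<open>The tangent of \<open>exp\<close> at \<open>m\<close>, the weighted mean of the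
  logarithms, lies below \<open>exp\<close>; averaging its values at the points
  \<open>ln (x i)\<close> gives back \<open>exp m\<close>.\<close>

lemma weighted_am_gm:
  fixes x \<theta> :: "'a \<Rightarrow> real"
  assumes "finite I" and "\<And>i. i \<in> I \<Longrightarrow> 0 \<le> x i" and \<theta>: "\<And>i. i \<in> I \<Longrightarrow> 0 \<le> \<theta> i"
    and sum: "(\<Sum>i\<in>I. \<theta> i) = 1"
  shows "(\<Prod>i\<in>I. x i powr \<theta> i) \<le> (\<Sum>i\<in>I. \<theta> i * x i)"
proof (cases "\<exists>i\<in>I. x i = 0")
  case True
  \<comment> \<open>Since \<open>0 powr 0 = 0\<close>, a vanishing \<open>x i\<close> kills the
    product even when its weight is zero.\<close>
  then have "(\<Prod>i\<in>I. x i powr \<theta> i) = 0" using \<open>finite I\<close> by force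
  moreover have "0 \<le> (\<Sum>i\<in>I. \<theta> i * x i)" using assms by (intro sum_nonneg) auto
  ultimately show ?thesis by simp
next
  case False
  then have pos: "\<And>i. i \<in> I \<Longrightarrow> 0 < x i" using assms(2) by (simp add: less_le)
  define m where "m = (\<Sum>i\<in>I. \<theta> i * ln (x i))"
  have "(\<Prod>i\<in>I. x i powr \<theta> i) = exp m"
    unfolding m_def exp_sum[OF \<open>finite I\<close>]
    by (intro prod.cong refl) (use pos in \<open>force simp: powr_def\<close>)
  also have "\<dots> = (\<Sum>i\<in>I. \<theta> i * (exp m * (1 + (ln (x i) - m))))"
  proof -
    have "(\<Sum>i\<in>I. \<theta> i * (exp m * (1 + (ln (x i) - m))))
        = (\<Sum>i\<in>I. exp m * \<theta> i + exp m * (\<theta> i * ln (x i)) - exp m * m * \<theta> i)"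
      by (intro sum.cong refl) (simp add: algebra_simps)
    also have "\<dots> = exp m * (\<Sum>i\<in>I. \<theta> i) + exp m * m - exp m * m * (\<Sum>i\<in>I. \<theta> i)"
      unfolding sum.distrib sum_subtractf sum_distrib_left[symmetric] m_def[symmetric] ..
    finally have "(\<Sum>i\<in>I. \<theta> i * (exp m * (1 + (ln (x i) - m)))) = \<dots>" .
    then show ?thesis using sum by simp
  qed
  also have "\<dots> \<le> (\<Sum>i\<in>I. \<theta> i * x i)"
  proof (intro sum_mono mult_left_mono \<theta>)
    fix i assume i: "i \<in> I"
    have "exp m * (1 + (ln (x i) - m)) \<le> exp m * exp (ln (x i) - m)"
      by (intro mult_left_mono exp_ge_add_one_self) auto
    also have "\<dots> = x i" using pos[OF i] by (simp add: exp_add[symmetric])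
    finally show "exp m * (1 + (ln (x i) - m)) \<le> x i" .
  qed
  finally show ?thesis .
qed

text \<open>Normalize each row \<open>t i\<close> by its total \<open>T i\<close> and apply weighted
  AM-GM for every \<open>j\<close>; summing over \<open>j\<close> turns the weighted means into the
  sum of the \<open>\<theta> i\<close>, which is 1.\<close>

lemma sum_prod_powr_le:
  fixes t :: "'a \<Rightarrow> 'b \<Rightarrow> real"
  assumes "finite I" and "finite J" and t: "\<And>i j. i \<in> I \<Longrightarrow> j \<in> J \<Longrightarrow> 0 \<le> t i j"
    and \<theta>: "\<And>i. i \<in> I \<Longrightarrow> 0 \<le> \<theta> i" and sum: "(\<Sum>i\<in>I. \<theta> i) = 1"
  shows "(\<Sum>j\<in>J. \<Prod>i\<in>I. t i j powr \<theta> i) \<le> (\<Prod>i\<in>I. (\<Sum>j\<in>J. t i j) powr \<theta> i)"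
proof (cases "\<exists>i\<in>I. (\<Sum>j\<in>J. t i j) = 0")
  case True
  then obtain i where i: "i \<in> I" "(\<Sum>j\<in>J. t i j) = 0" by blast
  then have "\<And>j. j \<in> J \<Longrightarrow> t i j = 0"
    using sum_nonneg_eq_0_iff[OF \<open>finite J\<close>, of "t i"] t by auto
  then have "(\<Sum>j\<in>J. \<Prod>i\<in>I. t i j powr \<theta> i) = 0"
    using i(1) \<open>finite I\<close> by (intro sum.neutral) force
  then show ?thesis by (simp add: prod_nonneg)
next
  case False
  define T where "T i = (\<Sum>j\<in>J. t i j)" for i
  have T: "0 < T i" if "i \<in> I" for i
    using that False t by (auto simp: T_def less_le intro!: sum_nonneg)
  have "(\<Prod>i\<in>I. t i j powr \<theta> i) \<le> (\<Prod>i\<in>I. T i powr \<theta> i) * (\<Sum>i\<in>I. \<theta> i * (t i j / T i))"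
    if j: "j \<in> J" for j
  proof -
    have "(\<Prod>i\<in>I. t i j powr \<theta> i) = (\<Prod>i\<in>I. T i powr \<theta> i) * (\<Prod>i\<in>I. (t i j / T i) powr \<theta> i)"
      unfolding prod.distrib[symmetric]
    proof (rule prod.cong[OF refl])
      fix i assume "i \<in> I"
      then have "0 < T i" "0 \<le> t i j" using T t j by auto
      then show "t i j powr \<theta> i = T i powr \<theta> i * (t i j / T i) powr \<theta> i"
        by (simp add: powr_divide)
    qed
    also have "\<dots> \<le> (\<Prod>i\<in>I. T i powr \<theta> i) * (\<Sum>i\<in>I. \<theta> i * (t i j / T i))"
      using t T j \<theta> by (intro mult_left_mono weighted_am_gm assms prod_nonneg)
        (auto intro: divide_nonneg_pos)
    finally show ?thesis .
  qed
  then have "(\<Sum>j\<in>J. \<Prod>i\<in>I. t i j powr \<theta> i)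
      \<le> (\<Sum>j\<in>J. (\<Prod>i\<in>I. T i powr \<theta> i) * (\<Sum>i\<in>I. \<theta> i * (t i j / T i)))"
    by (rule sum_mono)
  also have "\<dots> = (\<Prod>i\<in>I. T i powr \<theta> i) * (\<Sum>i\<in>I. \<theta> i * ((\<Sum>j\<in>J. t i j) / T i))"
    by (subst sum_distrib_left[symmetric], subst sum.swap)
       (simp add: sum_distrib_left sum_divide_distrib)
  also have "(\<Sum>i\<in>I. \<theta> i * ((\<Sum>j\<in>J. t i j) / T i)) = (\<Sum>i\<in>I. \<theta> i)"
    by (intro sum.cong refl) (use T in \<open>force simp: T_def\<close>)
  finally show ?thesis using sum by (simp add: T_def)
qed

section \<open>Diagonalization of real symmetric matrices\<close>

text \<open>Take a complex eigenvector \<open>v\<close>. By symmetry the Hermitian form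
  \<open>S\<close> of \<open>v\<close> is real, and it equals the eigenvalue \<open>z\<close> times
  the positive number \<open>N\<close>; so \<open>z\<close> is real. The real and imaginary parts of
  \<open>v\<close> then both satisfy the eigenvalue equation, and one of them is nonzero.\<close>

lemma real_symmetric_eigenvector_exists:
  fixes A :: "real mat"
  assumes A: "A \<in> carrier_mat n n" and sym: "transpose_mat A = A" and "0 < n"
  obtains u c where "u \<in> carrier_vec n" "u \<noteq> 0\<^sub>v n" "A *\<^sub>v u = c \<cdot>\<^sub>v u"
proof -
  define Ac where "Ac = map_mat complex_of_real A"
  have Ac: "Ac \<in> carrier_mat n n" using A by (simp add: Ac_def)
  have "\<not> constant (poly (char_poly Ac))"
    using degree_monic_char_poly[OF Ac] \<open>0 < n\<close> by (simp add: constant_degree)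
  then obtain z where "poly (char_poly Ac) z = 0"
    using fundamental_theorem_of_algebra by blast
  then have "eigenvalue Ac z" using eigenvalue_root_char_poly[OF Ac] by simp
  then obtain v where v: "v \<in> carrier_vec n" "v \<noteq> 0\<^sub>v n" "Ac *\<^sub>v v = z \<cdot>\<^sub>v v"
    unfolding eigenvalue_def eigenvector_def using Ac by auto
  have ev: "(\<Sum>j<n. of_real (A $$ (i, j)) * v $ j) = z * v $ i" if "i < n" for i
    using arg_cong[OF v(3), of "\<lambda>w. w $ i"] that v(1) A
    by (simp add: Ac_def scalar_prod_def lessThan_atLeast0)
  have symA: "A $$ (i, j) = A $$ (j, i)" if "i < n" "j < n" for i j
    using arg_cong[OF sym, of "\<lambda>M. M $$ (i, j)"] that A by simp
  define S where "S = (\<Sum>i<n. \<Sum>j<n. cnj (v $ i) * (of_real (A $$ (i, j)) * v $ j))"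
  have "cnj S = S"
  proof -
    have "cnj S = (\<Sum>i<n. \<Sum>j<n. cnj (v $ j) * (of_real (A $$ (i, j)) * v $ i))"
      by (simp add: S_def ac_simps)
    also have "\<dots> = (\<Sum>j<n. \<Sum>i<n. cnj (v $ j) * (of_real (A $$ (i, j)) * v $ i))"
      by (rule sum.swap)
    also have "\<dots> = S"
      unfolding S_def by (intro sum.cong refl) (simp add: symA)
    finally show ?thesis .
  qed
  define N where "N = (\<Sum>i<n. (cmod (v $ i))\<^sup>2)"
  have S: "S = z * of_real N"
  proof -
    have "S = (\<Sum>i<n. cnj (v $ i) * (z * v $ i))"
      unfolding S_def by (intro sum.cong refl) (simp add: sum_distrib_left[symmetric] ev)
    also have "\<dots> = (\<Sum>i<n. z * of_real ((cmod (v $ i))\<^sup>2))"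
      by (intro sum.cong refl) (simp only: complex_norm_square ac_simps)
    finally show ?thesis by (simp add: N_def sum_distrib_left)
  qed
  obtain i where "i < n" "v $ i \<noteq> 0" using v(1,2) by (auto simp: vec_eq_iff)
  then have "0 < N" unfolding N_def by (intro sum_pos2[of _ i]) auto
  with \<open>cnj S = S\<close> have "Im z = 0" unfolding S by (simp add: complex_eq_iff)
  have re: "A *\<^sub>v map_vec Re v = Re z \<cdot>\<^sub>v map_vec Re v"
  proof (rule eq_vecI)
    fix i assume "i < dim_vec (Re z \<cdot>\<^sub>v map_vec Re v)"
    then have "i < n" using v(1) by simp
    with arg_cong[OF ev[OF this], of Re] \<open>Im z = 0\<close> v(1) A
    show "(A *\<^sub>v map_vec Re v) $ i = (Re z \<cdot>\<^sub>v map_vec Re v) $ i"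
      by (simp add: scalar_prod_def lessThan_atLeast0)
  qed (use v(1) A in auto)
  have im: "A *\<^sub>v map_vec Im v = Re z \<cdot>\<^sub>v map_vec Im v"
  proof (rule eq_vecI)
    fix i assume "i < dim_vec (Re z \<cdot>\<^sub>v map_vec Im v)"
    then have "i < n" using v(1) by simp
    with arg_cong[OF ev[OF this], of Im] \<open>Im z = 0\<close> v(1) A
    show "(A *\<^sub>v map_vec Im v) $ i = (Re z \<cdot>\<^sub>v map_vec Im v) $ i"
      by (simp add: scalar_prod_def lessThan_atLeast0)
  qed (use v(1) A in auto)
  have "map_vec Re v \<noteq> 0\<^sub>v n \<or> map_vec Im v \<noteq> 0\<^sub>v n"
  proof (rule ccontr)
    assume "\<not> ?thesis"
    then have "map_vec Re v $ i = 0" "map_vec Im v $ i = 0" using \<open>i < n\<close> by auto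
    then show False using \<open>v $ i \<noteq> 0\<close> \<open>i < n\<close> v(1) by (simp add: complex_eq_iff)
  qed
  then show ?thesis using that[OF _ _ re] that[OF _ _ im] v(1) by auto
qed

lemma real_symmetric_unit_eigenvector_exists:
  fixes A :: "real mat"
  assumes A: "A \<in> carrier_mat n n" and "transpose_mat A = A" and "0 < n"
  obtains u c where "u \<in> carrier_vec n" "u \<bullet> u = 1" "A *\<^sub>v u = c \<cdot>\<^sub>v u"
proof -
  obtain u c where u: "u \<in> carrier_vec n" "u \<noteq> 0\<^sub>v n" "A *\<^sub>v u = c \<cdot>\<^sub>v u"
    using real_symmetric_eigenvector_exists[OF assms] .
  obtain i where "i < n" "u $ i \<noteq> 0" using u(1,2) by (auto simp: vec_eq_iff)
  then have "0 < u \<bullet> u"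
    using u(1) unfolding scalar_prod_def
    by (intro sum_pos2[of _ i]) (auto simp: zero_less_mult_iff)
  show ?thesis
  proof (rule that[of "(1 / sqrt (u \<bullet> u)) \<cdot>\<^sub>v u" c])
    show "A *\<^sub>v ((1 / sqrt (u \<bullet> u)) \<cdot>\<^sub>v u) = c \<cdot>\<^sub>v ((1 / sqrt (u \<bullet> u)) \<cdot>\<^sub>v u)"
      using u A by (simp add: mult_mat_vec smult_smult_assoc mult.commute)
  qed (use u \<open>0 < u \<bullet> u\<close> in \<open>auto simp: field_simps\<close>)
qed

text \<open>The reflection along \<open>w = u - e_0\<close> exchanges the unit vectors
  \<open>u\<close> and \<open>e_0\<close>. Being symmetric and an involution, it is orthogonal and
  its own inverse.\<close>

lemma householder_exists:
  fixes u :: "real vec"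
  assumes u: "u \<in> carrier_vec n" "u \<bullet> u = 1" and "0 < n"
  obtains H where "H \<in> carrier_mat n n" "transpose_mat H = H" "H * H = 1\<^sub>m n" "H *\<^sub>v unit_vec n 0 = u"
proof -
  define w where "w i = u $ i - (if i = 0 then 1 else 0)" for i
  define c where "c = (\<Sum>i<n. w i * w i)"
  \<comment> \<open>For \<open>c = 0\<close>, i.e. \<open>u = e\<^sub>0\<close>, the quotient is \<open>0\<close> and \<open>H\<close> is the identity.\<close>
  define H where "H = mat n n (\<lambda>(i, j). (if i = j then 1 else 0) - 2 * w i * w j / c)"
  have H: "H \<in> carrier_mat n n" by (simp add: H_def)
  \<comment> \<open>Unit length of \<open>u\<close> gives \<open>|u - e_0|^2 = 2 - 2 u_0\<close>.
    This turns the first column of \<open>H\<close> into \<open>e_0 + w = u\<close>.\<close>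
  have c: "c = - 2 * w 0"
  proof -
    have "c = (\<Sum>i<n. u $ i * u $ i) - 2 * u $ 0 + 1"
      unfolding c_def w_def lessThan_atLeast0
      using \<open>0 < n\<close> by (simp add: sum.atLeast_Suc_lessThan algebra_simps)
    then show ?thesis using u by (simp add: scalar_prod_def lessThan_atLeast0 w_def)
  qed
  have w0: "w i = 0" if "c = 0" "i < n" for i
    using that unfolding c_def by (subst (asm) sum_nonneg_eq_0_iff) auto
  have "H * H = 1\<^sub>m n"
  proof (rule eq_matI)
    fix i j assume "i < dim_row (1\<^sub>m n)" "j < dim_col (1\<^sub>m n)"
    then have ij: "i < n" "j < n" by auto
    let ?d = "\<lambda>i j. (if i = j then 1 else 0 :: real)"
    have "(H * H) $$ (i, j)
        = (\<Sum>k<n. (if i = k then ?d i j else 0) - (if i = k then 2 * w i * w j / c else 0)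
             - (if k = j then 2 * w i * w j / c else 0) + 4 * w i * w j / c^2 * (w k * w k))"
      using ij unfolding lessThan_atLeast0
      by (simp only: H_def scalar_prod_def index_mult_mat dim_row_mat dim_col_mat dim_col dim_vec row_mat col_mat)
        (intro sum.cong refl, simp add: algebra_simps power2_eq_square)
    also have "\<dots> = ?d i j - 2 * w i * w j / c - 2 * w i * w j / c + 4 * w i * w j / c^2 * c"
      unfolding sum.distrib sum_subtractf sum_distrib_left[symmetric] c_def[symmetric] using ij
      by (simp add: sum.delta sum.delta')
    also have "\<dots> = ?d i j" by (cases "c = 0") (auto simp: field_simps power2_eq_square)
    finally show "(H * H) $$ (i, j) = 1\<^sub>m n $$ (i, j)" using ij by simp
  qed (auto simp: H_def)
  moreover have "transpose_mat H = H" by (rule eq_matI) (auto simp: H_def)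
  moreover have "H *\<^sub>v unit_vec n 0 = u"
  proof (rule eq_vecI)
    fix i assume "i < dim_vec u"
    then have i: "i < n" using u by simp
    have "(H *\<^sub>v unit_vec n 0) $ i = H $$ (i, 0)" using H i \<open>0 < n\<close> by simp
    also have "\<dots> = (if i = 0 then 1 else 0) + w i"
      using c w0 i \<open>0 < n\<close> by (cases "c = 0") (auto simp: H_def field_simps)
    finally show "(H *\<^sub>v unit_vec n 0) $ i = u $ i" by (simp add: w_def)
  qed (use H u in auto)
  ultimately show ?thesis using that H by blast
qed

text \<open>Deflation: conjugating with a reflection that sends \<open>e_0\<close> to a unit
  eigenvector clears the first row and column off the diagonal. The remaining symmetric block
  \<open>B'\<close> is diagonalized by induction, and its eigenbasis is extended by a 1x1 identity
  block.\<close>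

lemma real_symmetric_diagonalizable:
  fixes A :: "real mat"
  assumes "A \<in> carrier_mat n n" and "transpose_mat A = A"
  shows "\<exists>V l. V \<in> carrier_mat n n \<and> transpose_mat V * V = 1\<^sub>m n \<and> A = V * mat_diag n l * transpose_mat V"
  using assms
proof (induction n arbitrary: A)
  case 0
  then show ?case by (intro exI[of _ "1\<^sub>m 0"]) (auto intro!: eq_matI)
next
  case (Suc n)
  let ?N = "Suc n"
  note A = Suc.prems(1) and sym = Suc.prems(2)
  obtain u c where u: "u \<in> carrier_vec ?N" "u \<bullet> u = 1" "A *\<^sub>v u = c \<cdot>\<^sub>v u"
    using real_symmetric_unit_eigenvector_exists[OF A sym] by blast
  obtain H where H: "H \<in> carrier_mat ?N ?N" "transpose_mat H = H" "H * H = 1\<^sub>m ?N"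
    and Hu: "H *\<^sub>v unit_vec ?N 0 = u"
    using householder_exists[OF u(1,2)] by blast
  define B where "B = H * A * H"
  have B: "B \<in> carrier_mat ?N ?N" using A H by (simp add: B_def)
  have symB: "transpose_mat B = B"
    using A H sym by (simp add: B_def transpose_mult[of _ ?N ?N _ ?N] assoc_mult_mat[of _ ?N ?N _ ?N _ ?N])
  have "H *\<^sub>v u = unit_vec ?N 0"
    using H Hu by (metis assoc_mult_mat_vec one_mult_mat_vec unit_vec_carrier)
  then have Bcol: "B *\<^sub>v unit_vec ?N 0 = c \<cdot>\<^sub>v unit_vec ?N 0"
    using A H u Hu by (simp add: B_def assoc_mult_mat_vec[of _ ?N ?N _ ?N] mult_mat_vec[of _ ?N ?N])
  have B0: "B $$ (i, 0) = (if i = 0 then c else 0)" if "i < ?N" for i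
    using arg_cong[OF Bcol, of "\<lambda>v. v $ i"] B that by auto
  have symB': "B $$ (i, j) = B $$ (j, i)" if "i < ?N" "j < ?N" for i j
    using arg_cong[OF symB, of "\<lambda>M. M $$ (i, j)"] that B by simp
  define B' where "B' = mat n n (\<lambda>(i, j). B $$ (Suc i, Suc j))"
  have B': "B' \<in> carrier_mat n n" by (simp add: B'_def)
  have "transpose_mat B' = B'" by (rule eq_matI) (auto simp: B'_def intro: symB')
  from Suc.IH[OF B' this] obtain V l where V: "V \<in> carrier_mat n n" "transpose_mat V * V = 1\<^sub>m n"
    and B'eq: "B' = V * mat_diag n l * transpose_mat V" by blast
  define W where "W = four_block_mat (1\<^sub>m 1) (0\<^sub>m 1 n) (0\<^sub>m n 1) V"
  define l' where "l' i = (case i of 0 \<Rightarrow> c | Suc k \<Rightarrow> l k)" for i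
  have W: "W \<in> carrier_mat ?N ?N"
    using four_block_carrier_mat[of "1\<^sub>m 1" 1 1 V n n] V by (simp add: W_def)
  have Wt: "transpose_mat W = four_block_mat (1\<^sub>m 1) (0\<^sub>m 1 n) (0\<^sub>m n 1) (transpose_mat V)"
    unfolding W_def using V by (subst transpose_four_block_mat[of _ 1 1 _ n _ n]) auto
  have WW: "transpose_mat W * W = 1\<^sub>m ?N"
    unfolding Wt unfolding W_def using V
    by (subst mult_four_block_mat[of _ 1 1 _ n _ n _ _ 1 _ n]) (auto simp: V(2))
  have D: "mat_diag ?N l' = four_block_mat (c \<cdot>\<^sub>m 1\<^sub>m 1) (0\<^sub>m 1 n) (0\<^sub>m n 1) (mat_diag n l)"
    by (rule eq_matI) (auto simp: mat_diag_def l'_def split: nat.splits)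
  have "B = four_block_mat (c \<cdot>\<^sub>m 1\<^sub>m 1) (0\<^sub>m 1 n) (0\<^sub>m n 1) B'"
  proof (rule eq_matI)
    fix i j assume "i < dim_row (four_block_mat (c \<cdot>\<^sub>m 1\<^sub>m 1) (0\<^sub>m 1 n) (0\<^sub>m n 1) B')"
      "j < dim_col (four_block_mat (c \<cdot>\<^sub>m 1\<^sub>m 1) (0\<^sub>m 1 n) (0\<^sub>m n 1) B')"
    then have "i < ?N" "j < ?N" using B' by auto
    then show "B $$ (i, j) = four_block_mat (c \<cdot>\<^sub>m 1\<^sub>m 1) (0\<^sub>m 1 n) (0\<^sub>m n 1) B' $$ (i, j)"
      using B0[of i] B0[of j] symB'[of i j] B' by (cases i; cases j) (auto simp: B'_def)
  qed (use B B' in auto)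
  also have "\<dots> = W * mat_diag ?N l' * transpose_mat W"
  proof -
    have "W * mat_diag ?N l' = four_block_mat (c \<cdot>\<^sub>m 1\<^sub>m 1) (0\<^sub>m 1 n) (0\<^sub>m n 1) (V * mat_diag n l)"
      unfolding D unfolding W_def using V
      by (subst mult_four_block_mat[of _ 1 1 _ n _ n _ _ 1 _ n])
        (auto intro!: cong_four_block_mat simp: right_mult_zero_mat[of _ n n] left_mult_zero_mat[of _ n n])
    then show ?thesis
      unfolding B'eq Wt using V mult_carrier_mat[OF V(1) mat_diag_dim[of n l]]
      by (simp only:, subst mult_four_block_mat[of _ 1 1 _ n _ n _ _ 1 _ n])
        (auto intro!: cong_four_block_mat simp: right_mult_zero_mat[of _ n n] left_mult_zero_mat[of _ n n])
  qed
  finally have Beq: "B = W * mat_diag ?N l' * transpose_mat W" .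
  have "A = (H * H) * A * (H * H)" using A by (simp add: H)
  also have "\<dots> = H * B * H"
    using A H(1) by (simp add: B_def assoc_mult_mat[of _ ?N ?N _ ?N _ ?N])
  also have "\<dots> = (H * W) * mat_diag ?N l' * transpose_mat (H * W)"
    unfolding Beq using H W by (simp add: assoc_mult_mat[of _ ?N ?N _ ?N _ ?N] mult_carrier_mat[of _ ?N ?N _ ?N] transpose_mult[of _ ?N ?N _ ?N])
  finally have "A = (H * W) * mat_diag ?N l' * transpose_mat (H * W)" .
  moreover have "transpose_mat (H * W) * (H * W) = transpose_mat W * (H * H) * W"
    using H(1,2) W by (simp add: assoc_mult_mat[of _ ?N ?N _ ?N _ ?N] transpose_mult[of _ ?N ?N _ ?N])
  then have "transpose_mat (H * W) * (H * W) = 1\<^sub>m ?N" using W H(3) WW by simp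
  ultimately show ?case using H(1) W by (intro exI[of _ "H * W"] exI[of _ l']) auto
qed

section \<open>Singular values and Schatten norms\<close>

lemma diag_congruence_index:
  assumes "V \<in> carrier_mat m n" and "W \<in> carrier_mat n' n" and "i < m" and "j < n'"
  shows "(V * mat_diag n l * transpose_mat W) $$ (i, j) = (\<Sum>k<n. V $$ (i, k) * l k * (W $$ (j, k) :: real))"
  using assms by (simp add: mat_diag_mult_right[OF assms(1)] scalar_prod_def lessThan_atLeast0)

lemma orthogonal_mat_index:
  fixes V :: "real mat"
  assumes "V \<in> carrier_mat m n" and "transpose_mat V * V = 1\<^sub>m n" and "i < n" and "j < n"
  shows "(\<Sum>k<m. V $$ (k, i) * V $$ (k, j)) = (if i = j then 1 else 0)"
  using arg_cong[OF assms(2), of "\<lambda>M. M $$ (i, j)"] assms(1,3,4)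
  by (simp add: scalar_prod_def lessThan_atLeast0)

lemma proots_linear_factors:
  "proots (\<Prod>a\<leftarrow>as. [:- a, 1:]) = mset (as :: real list)"
proof (induction as)
  case (Cons a as)
  have "(\<Prod>a\<leftarrow>as. [:- a, 1:]) \<noteq> 0" by (auto simp: prod_list_zero_iff)
  then have "proots ([:- a, 1:] * (\<Prod>a\<leftarrow>as. [:- a, 1:])) = {#a#} + mset as"
    using Cons by (subst proots_mult) auto
  then show ?case by simp
qed simp

lemma orthogonal_mat_inverse:
  fixes V :: "real mat"
  assumes "V \<in> carrier_mat n n" and "transpose_mat V * V = 1\<^sub>m n"
  shows "V * transpose_mat V = 1\<^sub>m n"
  using mat_mult_left_right_inverse[of "transpose_mat V" n V] assms by simp

lemma proots_char_poly_diagonalization: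
  fixes V :: "real mat"
  assumes V: "V \<in> carrier_mat n n" "transpose_mat V * V = 1\<^sub>m n"
  shows "proots (char_poly (V * mat_diag n l * transpose_mat V)) = image_mset l (mset_set {..<n})"
proof -
  have "similar_mat (V * mat_diag n l * transpose_mat V) (mat_diag n l)"
    using V orthogonal_mat_inverse[OF V]
    by (intro similar_matI[of _ _ V "transpose_mat V" n]) (auto intro!: mult_carrier_mat[of _ n n])
  then have "char_poly (V * mat_diag n l * transpose_mat V) = char_poly (mat_diag n l)"
    by (rule char_poly_similar)
  also have "\<dots> = (\<Prod>a\<leftarrow>diag_mat (mat_diag n l). [:- a, 1:])"
    by (rule char_poly_upper_triangular[OF mat_diag_dim]) (auto simp: mat_diag_def)
  also have "diag_mat (mat_diag n l) = map l [0..<n]"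
    by (auto simp: diag_mat_def mat_diag_def)
  finally show ?thesis
    by (simp only: proots_linear_factors mset_map mset_upt lessThan_atLeast0)
qed

text \<open>\<open>proots\<close> collects real roots only; for symmetric matrices, whose spectrum
  is real, none is lost.\<close>

definition eigenvalues_desc :: "real mat \<Rightarrow> real list" where
  "eigenvalues_desc A = rev (sorted_list_of_multiset (proots (char_poly A)))"

lemma eigenvalues_desc_antimono:
  "i \<le> j \<Longrightarrow> j < length (eigenvalues_desc A) \<Longrightarrow> eigenvalues_desc A ! j \<le> eigenvalues_desc A ! i"
  unfolding eigenvalues_desc_def by (auto simp: rev_nth intro!: sorted_nth_mono)

text \<open>Equal multisets of eigenvalues differ by a permutation \<open>f\<close>. Permuting the
  columns of any eigenbasis by \<open>f\<close> keeps it orthonormal and puts the eigenvalues into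
  the canonical decreasing order.\<close>

lemma real_symmetric_sorted_diagonalization:
  fixes A :: "real mat"
  assumes A: "A \<in> carrier_mat n n" and "transpose_mat A = A"
  obtains V where "V \<in> carrier_mat n n" "transpose_mat V * V = 1\<^sub>m n"
    "A = V * mat_diag n (\<lambda>j. eigenvalues_desc A ! j) * transpose_mat V"
    "length (eigenvalues_desc A) = n"
proof -
  obtain V l where V: "V \<in> carrier_mat n n" "transpose_mat V * V = 1\<^sub>m n"
    and Aeq: "A = V * mat_diag n l * transpose_mat V"
    using real_symmetric_diagonalizable[OF assms] by blast
  let ?L = "eigenvalues_desc A"
  have "mset ?L = proots (char_poly A)" by (simp add: eigenvalues_desc_def)
  also have "\<dots> = mset (map l [0..<n])"
    unfolding Aeq proots_char_poly_diagonalization[OF V] by (simp add: lessThan_atLeast0)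
  finally have ms: "mset ?L = mset (map l [0..<n])" .
  from mset_eq_length[OF this] have len: "length ?L = n" by simp
  from mset_eq_permutation[OF ms] obtain f where
    f: "f permutes {..<n}" and fL: "permute_list f (map l [0..<n]) = ?L" by auto
  have lf: "?L ! j = l (f j)" if "j < n" for j
    using that f permutes_in_image[OF f, of j]
    by (subst fL[symmetric], subst permute_list_nth) auto
  have fn: "f j < n" if "j < n" for j using permutes_in_image[OF f, of j] that by simp
  define W where "W = mat n n (\<lambda>(i, j). V $$ (i, f j))"
  have W: "W \<in> carrier_mat n n" by (simp add: W_def)
  have "transpose_mat W * W = 1\<^sub>m n"
  proof (rule eq_matI)
    fix i j assume "i < dim_row (1\<^sub>m n)" "j < dim_col (1\<^sub>m n)"
    then have ij: "i < n" "j < n" by auto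
    have "(transpose_mat W * W) $$ (i, j) = (\<Sum>k<n. V $$ (k, f i) * V $$ (k, f j))"
      using ij by (simp add: W_def scalar_prod_def lessThan_atLeast0)
    also have "\<dots> = (if f i = f j then 1 else 0)"
      using ij fn by (intro orthogonal_mat_index[OF V]) auto
    also have "\<dots> = 1\<^sub>m n $$ (i, j)" using ij permutes_inj[OF f] by (auto dest: injD)
    finally show "(transpose_mat W * W) $$ (i, j) = 1\<^sub>m n $$ (i, j)" .
  qed (use W in auto)
  moreover have "A = W * mat_diag n (\<lambda>j. ?L ! j) * transpose_mat W"
  proof (rule eq_matI)
    fix i j assume "i < dim_row (W * mat_diag n (\<lambda>j. ?L ! j) * transpose_mat W)"
      "j < dim_col (W * mat_diag n (\<lambda>j. ?L ! j) * transpose_mat W)"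
    then have ij: "i < n" "j < n" using W by auto
    have "A $$ (i, j) = (\<Sum>k<n. V $$ (i, k) * l k * V $$ (j, k))"
      by (subst Aeq) (rule diag_congruence_index[OF V(1) V(1) ij])
    also have "\<dots> = (\<Sum>k<n. V $$ (i, f k) * l (f k) * V $$ (j, f k))"
      by (rule sum.permute[OF f, unfolded o_def])
    also have "\<dots> = (\<Sum>k<n. W $$ (i, k) * ?L ! k * W $$ (j, k))"
      using ij by (intro sum.cong refl) (simp add: W_def lf)
    also have "\<dots> = (W * mat_diag n (\<lambda>j. ?L ! j) * transpose_mat W) $$ (i, j)"
      by (rule diag_congruence_index[OF W W ij, symmetric])
    finally show "A $$ (i, j) = (W * mat_diag n (\<lambda>j. ?L ! j) * transpose_mat W) $$ (i, j)" .
  qed (use A W in auto)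
  ultimately show ?thesis using that W len by blast
qed

text \<open>Padding the singular values by zeros beyond the number of columns makes all statements
  below independent of the matrix dimensions.\<close>

definition sv :: "real mat \<Rightarrow> nat \<Rightarrow> real" where
  "sv Y j = (if j < dim_col Y then sqrt (eigenvalues_desc (transpose_mat Y * Y) ! j) else 0)"

text \<open>Eigenvalue \<open>j\<close> is the squared length of column \<open>j\<close> of
  \<open>Y * V\<close>, hence nonnegative, so squaring undoes the square root in
  \<open>sv\<close>.\<close>

lemma gram_diagonalization:
  fixes Y :: "real mat"
  assumes Y: "Y \<in> carrier_mat m n"
  obtains V where "V \<in> carrier_mat n n" "transpose_mat V * V = 1\<^sub>m n"
    "transpose_mat Y * Y = V * mat_diag n (\<lambda>j. (sv Y j)\<^sup>2) * transpose_mat V"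
    "\<And>j. 0 \<le> sv Y j" "\<And>i j. i \<le> j \<Longrightarrow> sv Y j \<le> sv Y i"
proof -
  let ?A = "transpose_mat Y * Y"
  let ?L = "eigenvalues_desc ?A"
  have A: "?A \<in> carrier_mat n n" "transpose_mat ?A = ?A"
    using Y by (auto simp: transpose_mult[of _ n m _ n])
  obtain V where V: "V \<in> carrier_mat n n" "transpose_mat V * V = 1\<^sub>m n"
    and Aeq: "?A = V * mat_diag n (\<lambda>j. ?L ! j) * transpose_mat V"
    and len: "length ?L = n"
    using real_symmetric_sorted_diagonalization[OF A] .
  have L0: "0 \<le> ?L ! j" if j: "j < n" for j
  proof -
    have "transpose_mat V * ?A * V = (transpose_mat V * V) * mat_diag n (\<lambda>j. ?L ! j) * (transpose_mat V * V)"
      by (subst Aeq, insert V(1))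
        (simp add: assoc_mult_mat[of _ n n _ n _ n] mult_carrier_mat[of _ n n _ n])
    also have "\<dots> = mat_diag n (\<lambda>j. ?L ! j)" unfolding V(2)
      by (simp add: left_mult_one_mat[OF mat_diag_dim] right_mult_one_mat[OF mat_diag_dim])
    finally have "?L ! j = (transpose_mat V * ?A * V) $$ (j, j)" using j by (simp add: mat_diag_def)
    also have "transpose_mat V * ?A * V = transpose_mat (Y * V) * (Y * V)"
      using Y V(1) by (simp add: transpose_mult[of Y m n V n] assoc_mult_mat[of _ n n _ m _ n]
        assoc_mult_mat[of _ n m _ n _ n] assoc_mult_mat[of _ n n _ n _ n] mult_carrier_mat[of _ n m _ n] mult_carrier_mat[of _ m n _ n])
    also have "\<dots> $$ (j, j) = col (Y * V) j \<bullet> col (Y * V) j"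
      using j Y V(1) by simp
    also have "\<dots> \<ge> 0" by (auto simp: scalar_prod_def intro!: sum_nonneg)
    finally show ?thesis .
  qed
  have dec: "?L ! j \<le> ?L ! i" if "i \<le> j" "j < n" for i j
    using that len by (intro eigenvalues_desc_antimono) auto
  have sv2: "(sv Y j)\<^sup>2 = ?L ! j" if "j < n" for j
    using that L0[OF that] Y by (simp add: sv_def)
  have "mat_diag n (\<lambda>j. (sv Y j)\<^sup>2) = mat_diag n (\<lambda>j. ?L ! j)"
    by (rule eq_matI) (auto simp: mat_diag_def sv2)
  then show ?thesis
    using V Aeq L0 dec Y by (intro that[of V]) (auto simp: sv_def)
qed

lemma sv_nonneg: "0 \<le> sv Y j"
  by (rule gram_diagonalization[of Y "dim_row Y" "dim_col Y"]) auto

lemma sv_antimono: "i \<le> j \<Longrightarrow> sv Y j \<le> sv Y i"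
  by (rule gram_diagonalization[of Y "dim_row Y" "dim_col Y"]) auto

lemma sv_eq_0: "dim_col Y \<le> j \<Longrightarrow> sv Y j = 0"
  by (simp add: sv_def)

section \<open>Schatten norms from either Gram matrix\<close>

text \<open>The block matrix \<open>?K\<close> is made block triangular in two ways:
  \<open>?R\<close> on the right exposes the characteristic polynomial of \<open>A * B\<close>,
  \<open>?L\<close> on the left that of \<open>B * A\<close>. Comparing determinants gives the
  identity.\<close>

lemma char_poly_mult_comm:
  fixes A B :: "'a :: idom mat"
  assumes A: "A \<in> carrier_mat m n" and B: "B \<in> carrier_mat n m"
  shows "[:0, 1:] ^ n * char_poly (A * B) = [:0, 1:] ^ m * char_poly (B * A)"
proof -
  let ?c = "map_mat (\<lambda>a. [:a:])"
  let ?x = "[:0, 1:] :: 'a poly"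
  have cA: "?c A \<in> carrier_mat m n" and cB: "?c B \<in> carrier_mat n m" using A B by auto
  let ?K = "four_block_mat (?x \<cdot>\<^sub>m 1\<^sub>m m) (?c A) (?c B) (1\<^sub>m n)"
  let ?R = "four_block_mat (1\<^sub>m m) (0\<^sub>m m n) (- ?c B) (1\<^sub>m n)"
  let ?L = "four_block_mat (1\<^sub>m m) (0\<^sub>m m n) (- ?c B) (?x \<cdot>\<^sub>m 1\<^sub>m n)"
  have "?K \<in> carrier_mat (m + n) (m + n)" "?R \<in> carrier_mat (m + n) (m + n)"
    "?L \<in> carrier_mat (m + n) (m + n)"
    by (auto intro!: four_block_carrier_mat)
  note carr = this
  have cp: "char_poly (A * B) = det (?x \<cdot>\<^sub>m 1\<^sub>m m - ?c A * ?c B)"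
    unfolding char_poly_defs map_poly_mult(1)[OF A B, symmetric] using A B
    by (intro arg_cong[where f = det] eq_matI) auto
  have cp': "char_poly (B * A) = det (?x \<cdot>\<^sub>m 1\<^sub>m n - ?c B * ?c A)"
    unfolding char_poly_defs map_poly_mult(1)[OF B A, symmetric] using A B
    by (intro arg_cong[where f = det] eq_matI) auto
  have "?K * ?R = four_block_mat (?x \<cdot>\<^sub>m 1\<^sub>m m - ?c A * ?c B) (?c A) (0\<^sub>m n m) (1\<^sub>m n)"
    using cA cB
    by (subst mult_four_block_mat[of _ m m _ n _ n _ _ m _ n])
       (auto intro!: cong_four_block_mat eq_matI)
  then have "det ?K * det ?R = char_poly (A * B)"
    using cA cB unfolding det_mult[OF carr(1,2), symmetric] cp
    by (simp only:) (subst det_four_block_mat_lower_left_zero[of _ m _ n], auto)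
  moreover have "det ?R = 1"
    using cB by (subst det_four_block_mat_upper_right_zero[of _ m _ n]) auto
  ultimately have K: "det ?K = char_poly (A * B)" by simp
  have "?L * ?K = four_block_mat (?x \<cdot>\<^sub>m 1\<^sub>m m) (?c A) (0\<^sub>m n m) (?x \<cdot>\<^sub>m 1\<^sub>m n - ?c B * ?c A)"
    using cA cB
    by (subst mult_four_block_mat[of _ m m _ n _ n _ _ m _ n])
       (auto intro!: cong_four_block_mat eq_matI)
  then have "det ?L * det ?K = ?x ^ m * char_poly (B * A)"
    using cA cB unfolding det_mult[OF carr(3,1), symmetric] cp'
    by (simp only:) (subst det_four_block_mat_lower_left_zero[of _ m _ n], auto)
  moreover have "det ?L = ?x ^ n"
    using cB by (subst det_four_block_mat_upper_right_zero[of _ m _ n]) (auto simp: det_smult)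
  ultimately show ?thesis using K by simp
qed

text \<open>The two Gram spectra differ only in the number of zeros, which \<open>f\<close> ignores.
  Hence the choice of the smaller Gram matrix in \<open>gram_mat\<close> does not affect the
  Schatten norm.\<close>

lemma sum_gram_proots_comm:
  fixes Y :: "real mat" and f :: "real \<Rightarrow> real"
  assumes Y: "Y \<in> carrier_mat m n" and "f 0 = 0"
  shows "(\<Sum>x\<in>#proots (char_poly (Y * transpose_mat Y)). f x)
       = (\<Sum>x\<in>#proots (char_poly (transpose_mat Y * Y)). f x)"
proof -
  have nz: "char_poly A \<noteq> 0" if "A \<in> carrier_mat k k" for A :: "real mat" and k
    using degree_monic_char_poly[OF that] by auto
  have x: "proots ([:0, 1:] ^ k) = replicate_mset k (0 :: real)" for k
    unfolding proots_power by (subst proots_linear_factor) (induction k, auto)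
  have "[:0, 1:] ^ n * char_poly (Y * transpose_mat Y) = [:0, 1:] ^ m * char_poly (transpose_mat Y * Y)"
    using Y by (intro char_poly_mult_comm) auto
  from arg_cong[OF this, of "\<lambda>p. \<Sum>x\<in>#proots p. f x"]
  show ?thesis
    using nz[of "Y * transpose_mat Y" m] nz[of "transpose_mat Y * Y" n] Y \<open>f 0 = 0\<close>
    by (simp add: proots_mult x)
qed

lemma schatten_eq_proots_col_gram:
  assumes "Y \<in> carrier_mat m n"
  shows "schatten q Y = (\<Sum>x\<in>#proots (char_poly (transpose_mat Y * Y)). sqrt x powr q) powr (1 / q)"
  using sum_gram_proots_comm[OF assms, of "\<lambda>x. sqrt x powr q"]
  by (simp add: schatten_def singular_values_def gram_mat_def multiset.map_comp o_def)

lemma schatten_eq_proots_row_gram: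
  assumes "Y \<in> carrier_mat m n"
  shows "schatten q Y = (\<Sum>x\<in>#proots (char_poly (Y * transpose_mat Y)). sqrt x powr q) powr (1 / q)"
  using sum_gram_proots_comm[OF assms, of "\<lambda>x. sqrt x powr q"]
  by (simp add: schatten_eq_proots_col_gram[OF assms])

text \<open>The padding zeros contribute \<open>0 powr q = 0\<close>, so matrices with different
  numbers of columns can share one range of summation \<open>N\<close>.\<close>

lemma schatten_eq_sv:
  assumes Y: "Y \<in> carrier_mat m n" and "n \<le> N"
  shows "schatten q Y = (\<Sum>j<N. sv Y j powr q) powr (1 / q)"
proof -
  obtain V where V: "V \<in> carrier_mat n n" "transpose_mat V * V = 1\<^sub>m n"
    and eq: "transpose_mat Y * Y = V * mat_diag n (\<lambda>j. (sv Y j)\<^sup>2) * transpose_mat V"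
    using gram_diagonalization[OF Y] .
  have "(\<Sum>x\<in>#proots (char_poly (transpose_mat Y * Y)). sqrt x powr q) = (\<Sum>j<n. sv Y j powr q)"
    unfolding eq proots_char_poly_diagonalization[OF V]
    by (simp add: multiset.map_comp o_def sum_unfold_sum_mset[symmetric] sv_nonneg)
  also have "\<dots> = (\<Sum>j<N. sv Y j powr q)"
    using Y \<open>n \<le> N\<close> by (intro sum.mono_neutral_left) (auto simp: sv_def)
  finally show ?thesis by (simp add: schatten_eq_proots_col_gram[OF Y])
qed

lemma sum_proots_char_poly_diag_squares:
  assumes "\<And>j. 0 \<le> s j"
  shows "(\<Sum>x\<in>#proots (char_poly (mat_diag d (\<lambda>j. (s j)\<^sup>2))). sqrt x powr q) = (\<Sum>j<d. s j powr q)"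
proof -
  have "1\<^sub>m d * mat_diag d (\<lambda>j. (s j)\<^sup>2) * transpose_mat (1\<^sub>m d) = mat_diag d (\<lambda>j. (s j)\<^sup>2)"
    by (simp add: left_mult_one_mat[OF mat_diag_dim] right_mult_one_mat[OF mat_diag_dim])
  then show ?thesis
    using proots_char_poly_diagonalization[of "1\<^sub>m d" d "\<lambda>j. (s j)\<^sup>2"] assms
    by (simp add: multiset.map_comp o_def sum_unfold_sum_mset[symmetric])
qed

section \<open>Interlacing and Horn's inequality\<close>

text \<open>There are \<open>i\<close> equations in \<open>i + 1\<close> unknowns. Appending a zero
  row makes the system square with determinant 0, so its kernel is nontrivial.\<close>

lemma underdetermined_nontrivial_solution:
  fixes R :: "nat \<Rightarrow> nat \<Rightarrow> real"
  shows "\<exists>c. (\<exists>j\<le>i. c j \<noteq> 0) \<and> (\<forall>t<i. (\<Sum>j\<le>i. R t j * c j) = 0)"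
proof -
  define A where "A = mat (Suc i) (Suc i) (\<lambda>(t, j). if t < i then R t j else 0)"
  have A: "A \<in> carrier_mat (Suc i) (Suc i)" by (simp add: A_def)
  have "transpose_mat A *\<^sub>v unit_vec (Suc i) i = 0\<^sub>v (Suc i)"
    by (rule eq_vecI) (auto simp: A_def)
  moreover have "unit_vec (Suc i) i \<noteq> (0\<^sub>v (Suc i) :: real vec)"
    by (metis index_unit_vec(1) index_zero_vec(1) lessI zero_neq_one)
  ultimately have "\<exists>v. v \<in> carrier_vec (Suc i) \<and> v \<noteq> 0\<^sub>v (Suc i) \<and> transpose_mat A *\<^sub>v v = 0\<^sub>v (Suc i)"
    using unit_vec_carrier by blast
  then have "det (transpose_mat A) = 0"
    using det_0_iff_vec_prod_zero_field[of "transpose_mat A" "Suc i"] A by simp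
  then have "det A = 0" using det_transpose[OF A] by simp
  then obtain v where v: "v \<in> carrier_vec (Suc i)" "v \<noteq> 0\<^sub>v (Suc i)" "A *\<^sub>v v = 0\<^sub>v (Suc i)"
    using det_0_iff_vec_prod_zero_field[OF A] by auto
  show ?thesis
  proof (intro exI[of _ "\<lambda>j. v $ j"] conjI allI impI)
    show "\<exists>j\<le>i. v $ j \<noteq> 0" using v(1,2) by (auto simp: vec_eq_iff less_Suc_eq_le)
  next
    fix t assume "t < i"
    then have "(A *\<^sub>v v) $ t = (\<Sum>j\<le>i. R t j * v $ j)"
      using v(1) A unfolding atLeast0AtMost[symmetric] atLeastLessThanSuc_atLeastAtMost[symmetric]
      by (simp add: scalar_prod_def A_def)
    then show "(\<Sum>j\<le>i. R t j * v $ j) = 0" using v(3) \<open>t < i\<close> by simp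
  qed
qed

text \<open>The Courant--Fischer argument: a nonzero combination of the first \<open>i + 1\<close> columns of \<open>R\<close>
  is orthogonal to the first \<open>i\<close> coordinate directions.\<close>

lemma cauchy_interlacing:
  fixes R :: "nat \<Rightarrow> nat \<Rightarrow> real"
  assumes orth: "\<And>j j'. j < k \<Longrightarrow> j' < k \<Longrightarrow> (\<Sum>t<d. R t j * R t j') = (if j = j' then 1 else 0)"
    and diag: "\<And>j j'. j < k \<Longrightarrow> j' < k \<Longrightarrow> (\<Sum>t<d. l t * (R t j * R t j')) = (if j = j' then \<mu> j else 0)"
    and l: "\<And>i j. i \<le> j \<Longrightarrow> l j \<le> l i" and \<mu>: "\<And>i j. i \<le> j \<Longrightarrow> j < k \<Longrightarrow> \<mu> j \<le> \<mu> i"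
    and "i < k"
  shows "\<mu> i \<le> l i"
proof -
  obtain c where c: "\<exists>j\<le>i. c j \<noteq> 0" "\<And>t. t < i \<Longrightarrow> (\<Sum>j\<le>i. R t j * c j) = 0"
    using underdetermined_nontrivial_solution[of i R] by blast
  define s where "s t = (\<Sum>j\<le>i. R t j * c j)" for t
  \<comment> \<open>Stated for a general weight \<open>f\<close> because it is used twice: with
    \<open>f = l\<close> for the quadratic form and with \<open>f = 1\<close> for the squared
    length.\<close>
  have quad: "(\<Sum>t<d. f t * (s t)\<^sup>2) = (\<Sum>j\<le>i. (c j)\<^sup>2 * g j)"
    if "\<And>j j'. j \<le> i \<Longrightarrow> j' \<le> i \<Longrightarrow> (\<Sum>t<d. f t * (R t j * R t j')) = (if j = j' then g j else 0)"
    for f g :: "nat \<Rightarrow> real"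
  proof -
    have "(\<Sum>t<d. f t * (s t)\<^sup>2) = (\<Sum>t<d. \<Sum>j\<le>i. \<Sum>j'\<le>i. c j * c j' * (f t * (R t j * R t j')))"
      unfolding s_def power2_eq_square sum_product sum_distrib_left
      by (intro sum.cong refl) (simp add: sum_distrib_left ac_simps)
    also have "\<dots> = (\<Sum>j\<le>i. \<Sum>j'\<le>i. c j * c j' * (\<Sum>t<d. f t * (R t j * R t j')))"
      unfolding sum_distrib_left by (rule trans[OF sum.swap]) (intro sum.cong refl sum.swap)
    also have "\<dots> = (\<Sum>j\<le>i. \<Sum>j'\<le>i. if j = j' then (c j)\<^sup>2 * g j else 0)"
      by (intro sum.cong refl) (auto simp: that power2_eq_square)
    also have "\<dots> = (\<Sum>j\<le>i. (c j)\<^sup>2 * g j)" by (intro sum.cong refl) simp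
    finally show ?thesis .
  qed
  have pos: "0 < (\<Sum>j\<le>i. (c j)\<^sup>2)" using c(1) by (auto intro!: sum_pos2)
  have "\<mu> i * (\<Sum>j\<le>i. (c j)\<^sup>2) \<le> (\<Sum>j\<le>i. (c j)\<^sup>2 * \<mu> j)"
    unfolding sum_distrib_left mult.commute[of "\<mu> i"]
    using \<mu> \<open>i < k\<close> by (intro sum_mono mult_left_mono) auto
  also have "\<dots> = (\<Sum>t<d. l t * (s t)\<^sup>2)"
    using \<open>i < k\<close> by (intro quad[symmetric] diag) auto
  \<comment> \<open>By the choice of \<open>c\<close>, \<open>s t = 0\<close> for
    \<open>t < i\<close>; the surviving terms have \<open>l t \<le> l i\<close>.\<close>
  also have "\<dots> \<le> (\<Sum>t<d. l i * (s t)\<^sup>2)"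
  proof (rule sum_mono)
    fix t
    show "l t * (s t)\<^sup>2 \<le> l i * (s t)\<^sup>2"
      using c(2)[of t] l[of i t] by (cases "t < i") (auto simp: s_def intro: mult_right_mono)
  qed
  also have "\<dots> = l i * (\<Sum>j\<le>i. (c j)\<^sup>2)"
    using quad[of "\<lambda>_. 1" "\<lambda>_. 1"] orth \<open>i < k\<close> by (simp add: sum_distrib_left[symmetric])
  finally show ?thesis using pos by simp
qed

section \<open>Gram determinants and their growth under multiplication\<close>

lemma orthogonal_mat_det_square:
  fixes V :: "real mat"
  assumes "V \<in> carrier_mat n n" and "transpose_mat V * V = 1\<^sub>m n"
  shows "det V * det V = 1"
  using arg_cong[OF assms(2), of det] assms(1)
  by (simp add: det_mult[of _ n] det_transpose[of _ n])

lemma det_diagonalization: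
  fixes V :: "real mat"
  assumes V: "V \<in> carrier_mat n n" "transpose_mat V * V = 1\<^sub>m n"
  shows "det (V * mat_diag n l * transpose_mat V) = (\<Prod>j<n. l j)"
proof -
  have "det (mat_diag n l) = prod_list (diag_mat (mat_diag n l))"
    by (rule det_upper_triangular[OF _ mat_diag_dim]) (auto simp: mat_diag_def)
  also have "\<dots> = (\<Prod>j<n. l j)"
    by (simp add: prod_list_diag_prod mat_diag_def lessThan_atLeast0)
  finally have "det (mat_diag n l) = (\<Prod>j<n. l j)" .
  moreover have "det (V * mat_diag n l * transpose_mat V) = det V * det (mat_diag n l) * det V"
    using V(1) by (simp add: det_mult[of _ n] mult_carrier_mat[of _ n n] det_transpose[of _ n])
  ultimately show ?thesis using orthogonal_mat_det_square[OF V] by simp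
qed

lemma det_gram_eq_sv:
  assumes "Y \<in> carrier_mat m n"
  shows "det (transpose_mat Y * Y) = (\<Prod>j<n. (sv Y j)\<^sup>2)"
  by (rule gram_diagonalization[OF assms]) (simp add: det_diagonalization)

text \<open>In the eigenbasis of \<open>P\<close> the compression is \<open>Q^T D Q\<close> with
  orthonormal columns in \<open>Q\<close>. Rotating by an eigenbasis \<open>\<Omega>\<close> of it
  gives \<open>R\<close> with \<open>R^T D R\<close> diagonal, and interlacing compares the
  eigenvalues one by one.\<close>

lemma det_compression_le:
  fixes P :: "real mat"
  assumes W: "W \<in> carrier_mat d k" "transpose_mat W * W = 1\<^sub>m k"
    and V: "V \<in> carrier_mat d d" "transpose_mat V * V = 1\<^sub>m d"
    and P: "P = V * mat_diag d l * transpose_mat V"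
    and l: "\<And>i j. i \<le> j \<Longrightarrow> l j \<le> l i" "\<And>j. 0 \<le> l j"
  shows "det (transpose_mat W * P * W) \<le> (\<Prod>j<k. l j)"
proof -
  let ?D = "mat_diag d l"
  define Z where "Z = transpose_mat W * P * W"
  have carr: "Z \<in> carrier_mat k k" "P \<in> carrier_mat d d"
    using W(1) V(1) by (auto simp: Z_def P)
  define Q where "Q = transpose_mat V * W"
  have Q: "Q \<in> carrier_mat d k" using V W by (simp add: Q_def)
  have Qt: "transpose_mat Q = transpose_mat W * V"
    using V W by (simp add: Q_def transpose_mult[of _ d d _ k])
  have QQ: "transpose_mat Q * Q = 1\<^sub>m k"
  proof -
    have "transpose_mat Q * Q = transpose_mat W * (V * transpose_mat V) * W"
      unfolding Qt unfolding Q_def using V(1) W(1)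
      by (simp add: assoc_mult_mat[of _ k d _ d _ d] assoc_mult_mat[of _ k d _ d _ k] assoc_mult_mat[of _ d d _ d _ k])
    then show ?thesis using W V by (simp add: orthogonal_mat_inverse[OF V])
  qed
  have Z: "Z = transpose_mat Q * ?D * Q"
    unfolding Qt unfolding Q_def Z_def P using V(1) W(1)
    by (simp add: assoc_mult_mat[of _ k d _ d _ d] assoc_mult_mat[of _ k d _ d _ k] assoc_mult_mat[of _ d d _ d _ k]
      assoc_mult_mat[of _ d d _ d _ d] mult_carrier_mat[of _ d d _ d] mult_carrier_mat[of _ d d _ k])
  have "transpose_mat ?D = ?D" by (rule eq_matI) (auto simp: mat_diag_def)
  then have "transpose_mat Z = Z"
    unfolding Z using Q
    by (simp add: transpose_mult[of _ k d _ k] transpose_mult[of _ k d _ d] assoc_mult_mat[of _ k d _ d _ k] mult_carrier_mat[of _ k d _ d] mult_carrier_mat[of _ d d _ k] transpose_mult[of _ d d _ k])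
  from real_symmetric_sorted_diagonalization[OF carr(1) this] obtain \<Omega> where
    \<Omega>: "\<Omega> \<in> carrier_mat k k" "transpose_mat \<Omega> * \<Omega> = 1\<^sub>m k"
    and Zeq: "Z = \<Omega> * mat_diag k (\<lambda>j. eigenvalues_desc Z ! j) * transpose_mat \<Omega>"
    and len: "length (eigenvalues_desc Z) = k" .
  define \<mu> where "\<mu> j = eigenvalues_desc Z ! j" for j
  define R where "R = Q * \<Omega>"
  have R: "R \<in> carrier_mat d k" using Q \<Omega> by (simp add: R_def)
  have RR: "transpose_mat R * R = 1\<^sub>m k"
  proof -
    have "transpose_mat R * R = transpose_mat \<Omega> * (transpose_mat Q * Q) * \<Omega>"
      unfolding R_def using Q \<Omega>(1)
      by (simp add: transpose_mult[of _ d k _ k] assoc_mult_mat[of _ k k _ d _ k] assoc_mult_mat[of _ k k _ k _ k]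
       assoc_mult_mat[of _ k d _ k _ k] mult_carrier_mat[of _ d k _ k])
    then show ?thesis using \<Omega> by (simp add: QQ)
  qed
  have RDR: "transpose_mat R * ?D * R = mat_diag k \<mu>"
  proof -
    have "transpose_mat R * ?D * R = transpose_mat \<Omega> * Z * \<Omega>"
      unfolding R_def Z using Q \<Omega>(1)
      by (simp add: transpose_mult[of _ d k _ k] assoc_mult_mat[of _ k k _ d _ k] assoc_mult_mat[of _ k k _ d _ d] assoc_mult_mat[of _ k k _ k _ k]
       assoc_mult_mat[of _ k d _ k _ k] assoc_mult_mat[of _ d d _ k _ k] assoc_mult_mat[of _ k d _ d _ k]
       mult_carrier_mat[of _ d k _ k] mult_carrier_mat[of _ d d _ k] mult_carrier_mat[of _ k d _ d])
    also have "\<dots> = (transpose_mat \<Omega> * \<Omega>) * mat_diag k \<mu> * (transpose_mat \<Omega> * \<Omega>)"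
      unfolding \<mu>_def by (subst Zeq, insert \<Omega>(1))
        (simp add: assoc_mult_mat[of _ k k _ k _ k] mult_carrier_mat[of _ k k _ k])
    finally show ?thesis
      by (simp add: \<Omega>(2) left_mult_one_mat[OF mat_diag_dim] right_mult_one_mat[OF mat_diag_dim])
  qed
  have diag: "(\<Sum>t<d. l t * (R $$ (t, j) * R $$ (t, j'))) = (if j = j' then \<mu> j else 0)"
    if "j < k" "j' < k" for j j'
    using arg_cong[OF RDR, of "\<lambda>M. M $$ (j, j')"] that R
      diag_congruence_index[of "transpose_mat R" k d "transpose_mat R" k j j' l]
    by (auto simp: mat_diag_def ac_simps)
  have "\<mu> j \<le> l j" if "j < k" for j
    by (rule cauchy_interlacing[OF orthogonal_mat_index[OF R RR] diag l(1) _ that])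
      (auto simp: \<mu>_def len intro: eigenvalues_desc_antimono)
  \<comment> \<open>Each \<open>\<mu> j\<close> is a sum of squares weighted by \<open>l\<close>;
    this nonnegativity permits multiplying the inequalities.\<close>
  moreover have "0 \<le> \<mu> j" if "j < k" for j
    using diag[OF that that] l(2) by (metis (no_types, lifting) sum_nonneg mult_nonneg_nonneg zero_le_square)
  ultimately have "(\<Prod>j<k. \<mu> j) \<le> (\<Prod>j<k. l j)" by (intro prod_mono) auto
  moreover have "det Z = (\<Prod>j<k. \<mu> j)"
    using det_diagonalization[OF \<Omega>, of \<mu>] Zeq unfolding \<mu>_def by simp
  ultimately show ?thesis by (simp add: Z_def)
qed

text \<open>A nonzero Gram determinant makes all \<open>k\<close> singular values nonzero, so the
  columns of \<open>W * V\<close> can be rescaled by \<open>1 / sv W j\<close>; they then form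
  \<open>Q\<close>.\<close>

lemma orthonormalization:
  fixes W :: "real mat"
  assumes W: "W \<in> carrier_mat d k" and nz: "det (transpose_mat W * W) \<noteq> 0"
  obtains Q K where "Q \<in> carrier_mat d k" "transpose_mat Q * Q = 1\<^sub>m k" "K \<in> carrier_mat k k" "W = Q * K"
proof -
  obtain V where V: "V \<in> carrier_mat k k" "transpose_mat V * V = 1\<^sub>m k"
    and eq: "transpose_mat W * W = V * mat_diag k (\<lambda>j. (sv W j)\<^sup>2) * transpose_mat V"
    using gram_diagonalization[OF W] .
  have pos: "sv W j \<noteq> 0" if "j < k" for j
    using nz that unfolding det_gram_eq_sv[OF W] by auto
  let ?S = "mat_diag k (sv W)" and ?T = "mat_diag k (\<lambda>j. 1 / sv W j)"
  have TS: "?T * ?S = 1\<^sub>m k"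
    unfolding mat_diag_diag by (rule eq_matI) (auto simp: mat_diag_def pos)
  have Tt: "transpose_mat ?T = ?T" by (rule eq_matI) (auto simp: mat_diag_def)
  have T2: "?T * mat_diag k (\<lambda>j. (sv W j)\<^sup>2) * ?T = 1\<^sub>m k"
    unfolding mat_diag_diag by (rule eq_matI) (auto simp: mat_diag_def pos power2_eq_square)
  define Q where "Q = W * V * ?T"
  have "transpose_mat Q * Q = ?T * (transpose_mat V * (transpose_mat W * W) * V) * ?T"
    unfolding Q_def using W V(1)
    by (simp add: transpose_mult[of _ d k _ k] transpose_mult[of _ k k _ k] Tt assoc_mult_mat[of _ k k _ d _ k] assoc_mult_mat[of _ k k _ k _ d] assoc_mult_mat[of _ k k _ k _ k]
       assoc_mult_mat[of _ k d _ k _ k] assoc_mult_mat[of _ d k _ k _ k] mult_carrier_mat[of _ d k _ k]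
       mult_carrier_mat[of _ k d _ k] mult_carrier_mat[of _ k k _ k] mult_carrier_mat[of _ k k _ d])
  also have "transpose_mat V * (transpose_mat W * W) * V
      = (transpose_mat V * V) * mat_diag k (\<lambda>j. (sv W j)\<^sup>2) * (transpose_mat V * V)"
    unfolding eq using V(1) by (simp add: assoc_mult_mat[of _ k k _ k _ k] mult_carrier_mat[of _ k k _ k])
  also have "\<dots> = mat_diag k (\<lambda>j. (sv W j)\<^sup>2)"
    by (simp add: V(2) left_mult_one_mat[OF mat_diag_dim] right_mult_one_mat[OF mat_diag_dim])
  finally have "transpose_mat Q * Q = 1\<^sub>m k" unfolding T2 .
  moreover have "W = Q * (?S * transpose_mat V)"
  proof -
    have "Q * (?S * transpose_mat V) = W * V * (?T * ?S) * transpose_mat V"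
      unfolding Q_def using W V(1)
      by (simp add: assoc_mult_mat[of _ k k _ k _ k] assoc_mult_mat[of _ d k _ k _ k]
        mult_carrier_mat[of _ d k _ k] mult_carrier_mat[of _ k k _ k] del: mat_diag_diag)
    also have "\<dots> = W * (V * transpose_mat V)"
      unfolding TS using W V(1) by (simp add: assoc_mult_mat[of _ d k _ k _ k])
    finally show ?thesis using W by (simp add: orthogonal_mat_inverse[OF V])
  qed
  ultimately show ?thesis
    using that[of Q "?S * transpose_mat V"] W V(1) by (simp add: Q_def mult_carrier_mat[of _ k k _ k] mult_carrier_mat[of _ d k _ k])
qed

text \<open>If the columns of \<open>W\<close> are dependent, both sides vanish. Otherwise
  \<open>W = Q * K\<close> splits off \<open>(det K)^2\<close> on both sides, leaving the
  compression of \<open>Y^T Y\<close> to the orthonormal columns of \<open>Q\<close>.\<close>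

lemma det_gram_mult_le:
  assumes Y: "Y \<in> carrier_mat m d" and W: "W \<in> carrier_mat d k"
  shows "det (transpose_mat (Y * W) * (Y * W)) \<le> det (transpose_mat W * W) * (\<Prod>j<k. (sv Y j)\<^sup>2)"
proof (cases "det (transpose_mat W * W) = 0")
  case True
  then obtain v where v: "v \<in> carrier_vec k" "v \<noteq> 0\<^sub>v k" "transpose_mat W * W *\<^sub>v v = 0\<^sub>v k"
    using det_0_iff_vec_prod_zero_field[of "transpose_mat W * W" k] W by auto
  \<comment> \<open>A null vector of the Gram matrix satisfies \<open>|W v|^2 = 0\<close>, so it
    lies in the kernel of \<open>W\<close> and therefore in that of \<open>Y * W\<close>.\<close>
  have "(W *\<^sub>v v) \<bullet> (W *\<^sub>v v) = v \<bullet> (transpose_mat W *\<^sub>v (W *\<^sub>v v))"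
    using W v(1) transpose_vec_mult_scalar[of W d k v "W *\<^sub>v v"]
    by (simp add: comm_scalar_prod[of _ k])
  also have "transpose_mat W *\<^sub>v (W *\<^sub>v v) = 0\<^sub>v k"
    using v W by (simp add: assoc_mult_mat_vec[of _ k d _ k])
  finally have "(W *\<^sub>v v) \<bullet> (W *\<^sub>v v) = 0" using v(1) by simp
  then have "W *\<^sub>v v = 0\<^sub>v d"
    using W v(1) by (intro eq_vecI) (auto simp: scalar_prod_def sum_nonneg_eq_0_iff)
  moreover have "M *\<^sub>v 0\<^sub>v c = 0\<^sub>v r" if "M \<in> carrier_mat r c" for M :: "real mat" and r c
    by (rule eq_vecI) (use that in auto)
  ultimately have "transpose_mat (Y * W) * (Y * W) *\<^sub>v v = 0\<^sub>v k"
    using Y W v(1)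
    by (simp add: assoc_mult_mat_vec[of _ k m _ k] assoc_mult_mat_vec[of _ m d _ k] mult_carrier_mat[of _ m d _ k])
  then have "\<exists>v. v \<in> carrier_vec k \<and> v \<noteq> 0\<^sub>v k \<and> transpose_mat (Y * W) * (Y * W) *\<^sub>v v = 0\<^sub>v k"
    using v(1,2) by blast
  then have "det (transpose_mat (Y * W) * (Y * W)) = 0"
    using det_0_iff_vec_prod_zero_field[of "transpose_mat (Y * W) * (Y * W)" k] Y W
    by (simp add: mult_carrier_mat[of _ k m _ k] mult_carrier_mat[of _ m d _ k])
  then show ?thesis using True by simp
next
  case False
  obtain Q K where Q: "Q \<in> carrier_mat d k" "transpose_mat Q * Q = 1\<^sub>m k"
    and K: "K \<in> carrier_mat k k" and WQK: "W = Q * K"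
    using orthonormalization[OF W False] .
  obtain V where V: "V \<in> carrier_mat d d" "transpose_mat V * V = 1\<^sub>m d"
    and eq: "transpose_mat Y * Y = V * mat_diag d (\<lambda>j. (sv Y j)\<^sup>2) * transpose_mat V"
    using gram_diagonalization[OF Y] .
  let ?Z = "transpose_mat Q * (transpose_mat Y * Y) * Q"
  have Z: "?Z \<in> carrier_mat k k" using Q Y by auto
  have le: "det ?Z \<le> (\<Prod>j<k. (sv Y j)\<^sup>2)"
    by (rule det_compression_le[OF Q V eq]) (auto intro: power_mono sv_antimono sv_nonneg)
  have detK: "det (transpose_mat K * M * K) = (det K)\<^sup>2 * det M" if "M \<in> carrier_mat k k" for M
    using that K by (simp add: det_mult[of _ k] mult_carrier_mat[of _ k k _ k] det_transpose[of _ k] power2_eq_square)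
  have "transpose_mat (Y * W) * (Y * W) = transpose_mat K * ?Z * K"
    unfolding WQK using Y Q(1) K
    by (simp add: transpose_mult[of _ m d _ k] transpose_mult[of _ d k _ k]
      mult_carrier_mat[of _ d k _ k] mult_carrier_mat[of _ d d _ k] mult_carrier_mat[of _ m d _ k] mult_carrier_mat[of _ d m _ k]
      mult_carrier_mat[of _ d m _ d] mult_carrier_mat[of _ k d _ d] mult_carrier_mat[of _ m k _ k] mult_carrier_mat[of _ k d _ k]
      assoc_mult_mat[of _ k k _ d _ m] assoc_mult_mat[of _ k k _ d _ k] assoc_mult_mat[of _ k d _ m _ k]
      assoc_mult_mat[of _ k d _ d _ k] assoc_mult_mat[of _ d m _ d _ k] assoc_mult_mat[of _ k k _ k _ k] assoc_mult_mat[of _ k d _ k _ k] assoc_mult_mat[of _ d d _ k _ k]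
      assoc_mult_mat[of _ k d _ m _ d] assoc_mult_mat[of _ m d _ k _ k] assoc_mult_mat[of _ d m _ k _ k] assoc_mult_mat[of _ k m _ d _ k] assoc_mult_mat[of _ k k _ m _ k])
  then have "det (transpose_mat (Y * W) * (Y * W)) = (det K)\<^sup>2 * det ?Z"
    by (simp only: detK[OF Z])
  also have "\<dots> \<le> (det K)\<^sup>2 * (\<Prod>j<k. (sv Y j)\<^sup>2)" by (intro mult_left_mono le) simp
  also have "(det K)\<^sup>2 = det (transpose_mat W * W)"
  proof -
    have "transpose_mat W * W = transpose_mat K * (transpose_mat Q * Q) * K"
      unfolding WQK using Q(1) K
      by (simp add: transpose_mult[of _ d k _ k] mult_carrier_mat[of _ d k _ k] assoc_mult_mat[of _ k k _ d _ k]
        assoc_mult_mat[of _ k k _ k _ k] assoc_mult_mat[of _ k d _ k _ k])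
    then show ?thesis using detK[of "1\<^sub>m k"] by (simp only: Q(2)) simp
  qed
  finally show ?thesis .
qed

text \<open>\<open>W\<close> consists of the first \<open>k\<close> columns of the sorted eigenbasis
  \<open>V\<close>, so \<open>W^T V\<close> is an identity block followed by zeros and cuts out the
  leading block of the diagonal. The case \<open>k = n\<close> supplies the full basis for the
  construction of a factorization.\<close>

lemma leading_right_singular_vectors:
  assumes X: "X \<in> carrier_mat m n" and "k \<le> n"
  obtains W where "W \<in> carrier_mat n k" "transpose_mat W * W = 1\<^sub>m k"
    "transpose_mat (X * W) * (X * W) = mat_diag k (\<lambda>j. (sv X j)\<^sup>2)"
proof -
  let ?D = "mat_diag n (\<lambda>j. (sv X j)\<^sup>2)"
  obtain V where V: "V \<in> carrier_mat n n" "transpose_mat V * V = 1\<^sub>m n"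
    and eq: "transpose_mat X * X = V * ?D * transpose_mat V"
    using gram_diagonalization[OF X] .
  define W where "W = mat n k (\<lambda>(i, j). V $$ (i, j))"
  have W: "W \<in> carrier_mat n k" by (simp add: W_def)
  have WW: "transpose_mat W * W = 1\<^sub>m k"
    using orthogonal_mat_index[OF V] \<open>k \<le> n\<close>
    by (intro eq_matI) (auto simp: W_def scalar_prod_def lessThan_atLeast0)
  have E: "(transpose_mat W * V) $$ (i, j) = (if i = j then 1 else 0)" if "i < k" "j < n" for i j
    using orthogonal_mat_index[OF V, of i j] that \<open>k \<le> n\<close> V(1)
    by (simp add: W_def scalar_prod_def lessThan_atLeast0)
  have Et: "transpose_mat V * W = transpose_mat (transpose_mat W * V)"
    using V W by (simp add: transpose_mult[of _ k n _ n])
  have "transpose_mat (X * W) * (X * W) = transpose_mat W * (transpose_mat X * X) * W"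
    using X W by (simp add: transpose_mult[of _ m n _ k] assoc_mult_mat[of _ k n _ m _ k]
      assoc_mult_mat[of _ n m _ n _ k] assoc_mult_mat[of _ k n _ n _ k] mult_carrier_mat[of _ m n _ k] mult_carrier_mat[of _ n m _ n])
  also have "\<dots> = (transpose_mat W * V) * ?D * (transpose_mat V * W)"
    unfolding eq using V(1) W by (simp add: assoc_mult_mat[of _ n n _ n _ n] assoc_mult_mat[of _ k n _ n _ n]
      assoc_mult_mat[of _ n n _ n _ k] assoc_mult_mat[of _ k n _ n _ k] mult_carrier_mat[of _ n n _ n] mult_carrier_mat[of _ n n _ k]
      mult_carrier_mat[of _ k n _ n])
  also have "\<dots> = mat_diag k (\<lambda>j. (sv X j)\<^sup>2)"
  proof (rule eq_matI)
    fix i j assume "i < dim_row (mat_diag k (\<lambda>j. (sv X j)\<^sup>2))" "j < dim_col (mat_diag k (\<lambda>j. (sv X j)\<^sup>2))"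
    then have ij: "i < k" "j < k" by (auto simp: mat_diag_def)
    have "((transpose_mat W * V) * ?D * (transpose_mat V * W)) $$ (i, j)
        = (\<Sum>t<n. (transpose_mat W * V) $$ (i, t) * (sv X t)\<^sup>2 * (transpose_mat W * V) $$ (j, t))"
      unfolding Et by (rule diag_congruence_index[of _ k n _ k]) (use ij V W in auto)
    also have "\<dots> = (\<Sum>t<n. if t = i then (if i = j then (sv X j)\<^sup>2 else 0) else 0)"
      by (intro sum.cong refl) (auto simp: E[OF ij(1)] E[OF ij(2)])
    also have "\<dots> = mat_diag k (\<lambda>j. (sv X j)\<^sup>2) $$ (i, j)"
      using ij \<open>k \<le> n\<close> by (simp add: mat_diag_def)
    finally show "((transpose_mat W * V) * ?D * (transpose_mat V * W)) $$ (i, j)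
        = mat_diag k (\<lambda>j. (sv X j)\<^sup>2) $$ (i, j)" .
  qed (use V W in \<open>auto simp: mat_diag_def\<close>)
  finally show ?thesis using that W WW by blast
qed

section \<open>Horn's inequality for products of lists\<close>

lemma mat_list_prod_Cons: "As \<noteq> [] \<Longrightarrow> mat_list_prod (A # As) = A * mat_list_prod As"
  by (cases As) auto

text \<open>As \<open>mat_list_prod\<close> nests to the right, the tail applied to \<open>W\<close>
  takes the place of \<open>W\<close> for the head factor. The dimension claim travels along because
  the step for the head and associativity both rely on it.\<close>

lemma mat_list_prod_gram_le:
  assumes "Us \<noteq> []" and "\<And>i. Suc i < length Us \<Longrightarrow> dim_col (Us ! i) = dim_row (Us ! Suc i)"
    and W: "W \<in> carrier_mat (dim_col (last Us)) k"
  shows "mat_list_prod Us \<in> carrier_mat (dim_row (hd Us)) (dim_col (last Us))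
    \<and> det (transpose_mat (mat_list_prod Us * W) * (mat_list_prod Us * W))
      \<le> det (transpose_mat W * W) * (\<Prod>U\<leftarrow>Us. \<Prod>j<k. (sv U j)\<^sup>2)"
  using assms
proof (induction Us rule: list_nonempty_induct)
  case (single U)
  then show ?case using det_gram_mult_le[of U "dim_row U" "dim_col U" W k] by auto
next
  case (cons U Us)
  let ?P = "mat_list_prod Us"
  have W: "W \<in> carrier_mat (dim_col (last Us)) k" using cons.prems(2) cons.hyps by simp
  have chain: "dim_col (Us ! i) = dim_row (Us ! Suc i)" if "Suc i < length Us" for i
    using cons.prems(1)[of "Suc i"] that by simp
  have IH: "?P \<in> carrier_mat (dim_row (hd Us)) (dim_col (last Us))"
    "det (transpose_mat (?P * W) * (?P * W)) \<le> det (transpose_mat W * W) * (\<Prod>U\<leftarrow>Us. \<Prod>j<k. (sv U j)\<^sup>2)"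
    using cons.IH[OF chain W] by blast+
  have U: "U \<in> carrier_mat (dim_row U) (dim_row (hd Us))"
    using cons.prems(1)[of 0] cons.hyps by (auto simp: hd_conv_nth)
  have "det (transpose_mat (U * (?P * W)) * (U * (?P * W)))
      \<le> det (transpose_mat (?P * W) * (?P * W)) * (\<Prod>j<k. (sv U j)\<^sup>2)"
    using IH(1) W by (intro det_gram_mult_le[OF U]) auto
  also have "\<dots> \<le> det (transpose_mat W * W) * (\<Prod>U\<leftarrow>Us. \<Prod>j<k. (sv U j)\<^sup>2) * (\<Prod>j<k. (sv U j)\<^sup>2)"
    by (intro mult_right_mono IH(2) prod_nonneg) auto
  finally have "det (transpose_mat (U * ?P * W) * (U * ?P * W))
      \<le> det (transpose_mat W * W) * (\<Prod>U\<leftarrow>U # Us. \<Prod>j<k. (sv U j)\<^sup>2)"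
    unfolding assoc_mult_mat[OF U IH(1) W] by (simp add: ac_simps)
  moreover have "U * ?P \<in> carrier_mat (dim_row U) (dim_col (last Us))"
    using U IH(1) by (rule mult_carrier_mat)
  ultimately show ?case using cons.hyps by (simp add: mat_list_prod_Cons)
qed

text \<open>Apply the Gram bound to the leading right singular vectors of the product: the Gram
  determinant of \<open>W\<close> is then 1 and that of \<open>?X * W\<close> is the square of the
  left side.\<close>

lemma sv_mat_list_prod_le:
  assumes "Us \<noteq> []" and "\<And>i. Suc i < length Us \<Longrightarrow> dim_col (Us ! i) = dim_row (Us ! Suc i)"
  shows "(\<Prod>j<k. sv (mat_list_prod Us) j) \<le> (\<Prod>j<k. \<Prod>i<length Us. sv (Us ! i) j)"
proof -
  let ?X = "mat_list_prod Us"
  let ?n = "dim_col (last Us)"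
  have X: "?X \<in> carrier_mat (dim_row (hd Us)) ?n"
    using mat_list_prod_gram_le[OF assms, of "1\<^sub>m ?n" ?n] by simp
  have nonneg: "0 \<le> (\<Prod>j<k. \<Prod>i<length Us. sv (Us ! i) j)"
    by (intro prod_nonneg ballI sv_nonneg)
  show ?thesis
  proof (cases "k \<le> ?n")
    case False
    \<comment> \<open>The index \<open>?n\<close> lies below \<open>k\<close> and already belongs to
      the zero padding.\<close>
    then have "sv ?X ?n = 0" using X by (intro sv_eq_0) auto
    then have "(\<Prod>j<k. sv ?X j) = 0" using False by (intro prod_zero) auto
    with nonneg show ?thesis by linarith
  next
    case True
    then obtain W where W: "W \<in> carrier_mat ?n k" "transpose_mat W * W = 1\<^sub>m k"
      and gram: "transpose_mat (?X * W) * (?X * W) = mat_diag k (\<lambda>j. (sv ?X j)\<^sup>2)"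
      using leading_right_singular_vectors[OF X] by blast
    have "(\<Prod>j<k. sv ?X j)\<^sup>2 = det (transpose_mat (?X * W) * (?X * W))"
      using det_diagonalization[of "1\<^sub>m k" k "\<lambda>j. (sv ?X j)\<^sup>2"]
      unfolding gram
      by (simp add: left_mult_one_mat[OF mat_diag_dim] right_mult_one_mat[OF mat_diag_dim] prod_power_distrib)
    also have "\<dots> \<le> (\<Prod>U\<leftarrow>Us. \<Prod>j<k. (sv U j)\<^sup>2)"
      using mat_list_prod_gram_le[OF assms W(1)] W(2) by simp
    also have "\<dots> = (\<Prod>i<length Us. \<Prod>j<k. (sv (Us ! i) j)\<^sup>2)"
      by (simp add: prod.list_conv_set_nth lessThan_atLeast0)
    also have "\<dots> = (\<Prod>j<k. \<Prod>i<length Us. sv (Us ! i) j)\<^sup>2"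
      by (subst prod.swap) (simp add: prod_power_distrib)
    finally show ?thesis using nonneg by (rule power2_le_imp_le)
  qed
qed

section \<open>Lower bounds for factorizations\<close>

lemma schatten_factorization_le:
  fixes m n d M :: nat and ps :: "nat \<Rightarrow> real"
  assumes "2 \<le> M" and "0 < p" and ps: "\<forall>i<M. 0 < ps i" and sum: "(\<Sum>i<M. 1 / ps i) = 1 / p"
    and fac: "factorization m n d M X Us"
  shows "schatten p X \<le> (\<Prod>i<M. schatten (ps i) (Us ! i))"
proof -
  \<comment> \<open>Large enough for the columns of \<open>X\<close> and of every factor.\<close>
  define N where "N = max n d"
  have U: "Us ! i \<in> carrier_mat (if i = 0 then m else d) (if i = M - 1 then n else d)" if "i < M" for i
    using that fac \<open>2 \<le> M\<close> unfolding factorization_def by (cases "i = 0"; cases "i = M - 1") auto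
  have len: "length Us = M" "Us \<noteq> []" and prod: "mat_list_prod Us = X"
    using fac \<open>2 \<le> M\<close> by (auto simp: factorization_def)
  have chain: "dim_col (Us ! i) = dim_row (Us ! Suc i)" if "Suc i < length Us" for i
    using U[of i] U[of "Suc i"] that len by auto
  have "X \<in> carrier_mat (dim_row (hd Us)) (dim_col (last Us))"
    using mat_list_prod_gram_le[OF len(2) chain, of "1\<^sub>m (dim_col (last Us))" "dim_col (last Us)"] prod by auto
  then have X: "X \<in> carrier_mat (dim_row X) n"
    using U[of "M - 1"] \<open>2 \<le> M\<close> len by (auto simp: last_conv_nth)
  define \<theta> where "\<theta> i = p / ps i" for i
  have \<theta>: "0 \<le> \<theta> i" if "i < M" for i using that ps \<open>0 < p\<close> by (auto simp: \<theta>_def)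
  have \<theta>_sum: "(\<Sum>i<M. \<theta> i) = 1"
    using arg_cong[OF sum, of "\<lambda>x. p * x"] \<open>0 < p\<close> by (simp add: \<theta>_def sum_distrib_left)
  define S where "S i = (\<Sum>j<N. sv (Us ! i) j powr ps i)" for i
  \<comment> \<open>Horn's inequalities, one for each length of the partial products, are the
    hypotheses of log-majorization.\<close>
  have "(\<Sum>j<N. sv X j powr p) \<le> (\<Sum>j<N. (\<Prod>i<M. sv (Us ! i) j) powr p)"
    using sv_mat_list_prod_le[OF len(2) chain] \<open>0 < p\<close>
    by (intro sum_powr_le_if_prods_le) (auto simp: len prod sv_antimono sv_nonneg intro!: prod_nonneg)
  \<comment> \<open>Splitting the exponent as \<open>p = ps i * \<theta> i\<close> produces the form
    to which Hoelder's inequality applies.\<close>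
  also have "\<dots> = (\<Sum>j<N. \<Prod>i<M. (sv (Us ! i) j powr ps i) powr \<theta> i)"
  proof (rule sum.cong[OF refl])
    fix j
    have "(\<Prod>i<M. sv (Us ! i) j) powr p = (\<Prod>i<M. sv (Us ! i) j powr p)"
      by (rule prod_powr_distrib)
    also have "\<dots> = (\<Prod>i<M. (sv (Us ! i) j powr ps i) powr \<theta> i)"
      using ps by (intro prod.cong refl) (auto simp: powr_powr \<theta>_def less_imp_neq[symmetric])
    finally show "(\<Prod>i<M. sv (Us ! i) j) powr p = \<dots>" .
  qed
  also have "\<dots> \<le> (\<Prod>i<M. S i powr \<theta> i)"
    unfolding S_def by (rule sum_prod_powr_le) (auto simp: \<theta> \<theta>_sum)
  finally have le: "(\<Sum>j<N. sv X j powr p) \<le> (\<Prod>i<M. S i powr \<theta> i)" .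
  have S0: "0 \<le> S i" for i by (simp add: S_def sum_nonneg)
  have "schatten p X = (\<Sum>j<N. sv X j powr p) powr (1 / p)"
    by (rule schatten_eq_sv[OF X]) (simp add: N_def)
  also have "\<dots> \<le> (\<Prod>i<M. S i powr \<theta> i) powr (1 / p)"
    using \<open>0 < p\<close> by (intro powr_mono2 le) (auto intro: sum_nonneg)
  also have "\<dots> = (\<Prod>i<M. (S i powr \<theta> i) powr (1 / p))"
    by (rule prod_powr_distrib)
  also have "\<dots> = (\<Prod>i<M. schatten (ps i) (Us ! i))"
  proof (rule prod.cong[OF refl])
    fix i assume "i \<in> {..<M}"
    then have i: "i < M" by simp
    have "schatten (ps i) (Us ! i) = S i powr (1 / ps i)"
      unfolding S_def by (rule schatten_eq_sv[OF U[OF i]]) (auto simp: N_def)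
    then show "(S i powr \<theta> i) powr (1 / p) = schatten (ps i) (Us ! i)"
      using \<open>0 < p\<close> by (simp add: powr_powr \<theta>_def)
  qed
  finally show ?thesis .
qed

text \<open>Weighted AM-GM for the numbers \<open>x i powr ps i\<close> with weights
  \<open>p / ps i\<close>, followed by the power \<open>1 / p\<close>.\<close>

lemma prod_le_weighted_power_mean:
  fixes x ps :: "nat \<Rightarrow> real"
  assumes "0 < p" and ps: "\<forall>i<M. 0 < ps i" and sum: "(\<Sum>i<M. 1 / ps i) = 1 / p"
    and x: "\<And>i. 0 \<le> x i"
  shows "(\<Prod>i<M. x i) \<le> ((\<Sum>i<M. x i powr ps i / ps i) / (1 / p)) powr (1 / p)"
proof -
  have "(\<Prod>i<M. (x i powr ps i) powr (p / ps i)) \<le> (\<Sum>i<M. p / ps i * x i powr ps i)"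
  proof (rule weighted_am_gm)
    show "(\<Sum>i<M. p / ps i) = 1"
      using arg_cong[OF sum, of "\<lambda>x. p * x"] \<open>0 < p\<close> by (simp add: sum_distrib_left)
  qed (use ps \<open>0 < p\<close> in auto)
  also have "(\<Prod>i<M. (x i powr ps i) powr (p / ps i)) = (\<Prod>i<M. x i powr p)"
    using ps by (intro prod.cong refl) (auto simp: powr_powr less_imp_neq[symmetric])
  also have "\<dots> = (\<Prod>i<M. x i) powr p"
    by (rule prod_powr_distrib[symmetric])
  also have "(\<Sum>i<M. p / ps i * x i powr ps i) = (\<Sum>i<M. x i powr ps i / ps i) / (1 / p)"
    by (simp add: sum_distrib_left ac_simps)
  finally have "((\<Prod>i<M. x i) powr p) powr (1 / p) \<le> ((\<Sum>i<M. x i powr ps i / ps i) / (1 / p)) powr (1 / p)"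
    using \<open>0 < p\<close> by (intro powr_mono2) auto
  then show ?thesis using \<open>0 < p\<close> x by (simp add: powr_powr prod_nonneg)
qed

lemma schatten_nonneg: "0 \<le> schatten q Y"
  by (simp add: schatten_def)

section \<open>A balanced factorization\<close>

lemma (in vec_space) rank_mult_right_le:
  assumes A: "A \<in> carrier_mat n nc" and B: "B \<in> carrier_mat nc k"
  shows "rank (A * B) \<le> rank A"
proof -
  have AB: "A * B \<in> carrier_mat n k" using A B by simp
  have "col_space (A * B) \<subseteq> col_space A"
    unfolding col_space_eq[OF A] col_space_eq[OF AB] using A B
    by (auto simp: assoc_mult_mat_vec[OF A B])
  then have sub: "span (set (cols (A * B))) \<subseteq> span (set (cols A))"
    by (simp add: col_space_def)
  have s: "VectorSpace.subspace class_ring (span (set (cols M))) V" if "M \<in> carrier_mat n k" for M k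
    using that cols_dim[of M] by (intro span_is_subspace) auto
  have "VectorSpace.subspace class_ring (span (set (cols (A * B)))) (vs (span (set (cols A))))"
    using nested_subspaces[OF s[OF A] s[OF AB] sub] .
  then show ?thesis
    unfolding rank_def
    using vectorspace.subspace_dim[OF subspace_is_vs[OF s[OF A]]]
      fin_dim_span_cols[OF A] fin_dim_span_cols[OF AB] by auto
qed

lemma (in vec_space) rank_full_if_gram_diag:
  assumes B: "B \<in> carrier_mat n k" and gram: "transpose_mat B * B = mat_diag k s"
    and nz: "\<And>j. j < k \<Longrightarrow> s j \<noteq> 0"
  shows "rank B = k"
proof (rule lin_indpt_full_rank[OF B])
  \<comment> \<open>Independence is stated for the set of columns, so repetitions are excluded
    first: a repeated column would put a nonzero entry off the diagonal of the Gram matrix.\<close>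
  show dist: "distinct (cols B)"
  proof (unfold distinct_conv_nth, intro allI impI notI)
    fix i j assume "i < length (cols B)" "j < length (cols B)" "i \<noteq> j" "cols B ! i = cols B ! j"
    then have ij: "i < k" "j < k" "col B i = col B j" using B by auto
    then have "(transpose_mat B * B) $$ (i, j) = (transpose_mat B * B) $$ (i, i)" using B by simp
    then show False unfolding gram using ij \<open>i \<noteq> j\<close> nz[of i] by (simp add: mat_diag_def)
  qed
  show "lin_indpt (set (cols B))"
  proof
    assume "lin_dep (set (cols B))"
    from lin_depE[OF B this dist] obtain v where v: "v \<in> carrier_vec k" "v \<noteq> 0\<^sub>v k" "B *\<^sub>v v = 0\<^sub>v n" .
    have "mat_diag k s *\<^sub>v v = transpose_mat B *\<^sub>v (B *\<^sub>v v)"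
      unfolding gram[symmetric] using B v(1) by (simp add: assoc_mult_mat_vec[of _ k n _ k])
    also have "\<dots> = 0\<^sub>v k" unfolding v(3) using B by (intro eq_vecI) auto
    finally have z: "mat_diag k s *\<^sub>v v = 0\<^sub>v k" .
    have "v $ j = 0" if "j < k" for j
    proof -
      have "(mat_diag k s *\<^sub>v v) $ j = (\<Sum>i<k. if i = j then s j * v $ j else 0)"
        using that v(1) unfolding lessThan_atLeast0
        by (simp only: mat_diag_def index_mult_mat_vec dim_row_mat row_mat scalar_prod_def carrier_vecD)
           (intro sum.cong refl, auto)
      with that nz[OF that] show ?thesis unfolding z by simp
    qed
    then show False using v(1,2) by (auto simp: vec_eq_iff)
  qed
qed

text \<open>If \<open>sv X j\<close> is nonzero, so are all earlier singular values, and the images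
  of the first \<open>j + 1\<close> right singular vectors have a nonsingular diagonal Gram matrix.
  Thus \<open>X * W\<close>, and with it \<open>X\<close>, has rank at least
  \<open>j + 1\<close>.\<close>

lemma sv_nonzero_imp_less_rank:
  assumes X: "X \<in> carrier_mat m n" and "sv X j \<noteq> 0"
  shows "j < vec_space.rank m X"
proof -
  have nz: "sv X i \<noteq> 0" if "i < Suc j" for i
    using that assms(2) sv_antimono[of i j X] sv_nonneg[of X j] by simp
  have "Suc j \<le> n" using assms by (auto simp: sv_def split: if_splits)
  then obtain W where W: "W \<in> carrier_mat n (Suc j)"
    and gram: "transpose_mat (X * W) * (X * W) = mat_diag (Suc j) (\<lambda>j. (sv X j)\<^sup>2)"
    using leading_right_singular_vectors[OF X] by metis
  have "vec_space.rank m (X * W) = Suc j"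
    using X W nz by (intro vec_space.rank_full_if_gram_diag[OF _ gram]) auto
  then show ?thesis using vec_space.rank_mult_right_le[OF X W] by simp
qed

section \<open>Distributing powers of the singular values over the factors\<close>

lemma mult_transpose_index:
  assumes "A \<in> carrier_mat m n" and "B \<in> carrier_mat n' n" and "i < m" and "j < n'"
  shows "(A * transpose_mat B) $$ (i, j) = (\<Sum>k<n. A $$ (i, k) * B $$ (j, k))"
  using assms by (simp add: scalar_prod_def lessThan_atLeast0)

lemma balanced_factorization_exists:
  fixes m n d M :: nat and X :: "real mat" and \<theta> :: "nat \<Rightarrow> real"
  assumes X: "X \<in> carrier_mat m n" and rank: "vec_space.rank m X \<le> d" and "2 \<le> M"
    and \<theta>_sum: "(\<Sum>i<M. \<theta> i) = 1"
  obtains Us where "factorization m n d M X Us"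
    "\<And>i q. i < M \<Longrightarrow> schatten q (Us ! i) = (\<Sum>j<d. (sv X j powr \<theta> i) powr q) powr (1 / q)"
proof -
  define \<sigma> where "\<sigma> = sv X"
  have \<sigma>0: "0 \<le> \<sigma> j" for j by (simp add: \<sigma>_def sv_nonneg)
  have \<sigma>n: "\<sigma> j = 0" if "n \<le> j" for j using that X by (simp add: \<sigma>_def sv_eq_0)
  have \<sigma>d: "\<sigma> j = 0" if "d \<le> j" for j
    using that sv_nonzero_imp_less_rank[OF X, of j] rank unfolding \<sigma>_def by linarith
  obtain V where V: "V \<in> carrier_mat n n" "transpose_mat V * V = 1\<^sub>m n"
    and gram: "transpose_mat (X * V) * (X * V) = mat_diag n (\<lambda>j. (\<sigma> j)\<^sup>2)"
    using leading_right_singular_vectors[OF X order_refl] unfolding \<sigma>_def .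
  have XV: "X * V \<in> carrier_mat m n" using X V by simp
  have XV_gram: "(\<Sum>a<m. (X * V) $$ (a, i) * (X * V) $$ (a, j)) = (if i = j then (\<sigma> j)\<^sup>2 else 0)"
    if "i < n" "j < n" for i j
    using arg_cong[OF gram, of "\<lambda>A. A $$ (i, j)"] that XV X V(1)
    by (simp add: scalar_prod_def lessThan_atLeast0 mat_diag_def)
  have XV0: "(X * V) $$ (a, j) = 0" if "\<sigma> j = 0" "a < m" "j < n" for a j
  proof -
    have "(\<Sum>a<m. (X * V) $$ (a, j) * (X * V) $$ (a, j)) = 0"
      using XV_gram[OF that(3) that(3)] that(1) by simp
    then show ?thesis using that(2) by (subst (asm) sum_nonneg_eq_0_iff) auto
  qed
  \<comment> \<open>Column \<open>j\<close> of \<open>X * V\<close> already has length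
    \<open>\<sigma> j\<close>, hence the exponent \<open>\<theta> 0 - 1\<close>. Where
    \<open>\<sigma> j = 0\<close>, in particular for \<open>j \<ge> n\<close>, the convention
    \<open>0 powr _ = 0\<close> gives a zero column, also if the index lies outside
    \<open>X * V\<close>. The same holds for the rows of \<open>UM\<close>.\<close>
  define U0 where "U0 = mat m d (\<lambda>(a, j). (X * V) $$ (a, j) * \<sigma> j powr (\<theta> 0 - 1))"
  define UM where "UM = mat d n (\<lambda>(j, b). \<sigma> j powr \<theta> (M - 1) * V $$ (b, j))"
  define U where "U i = (if i = 0 then U0 else if i = M - 1 then UM else mat_diag d (\<lambda>j. \<sigma> j powr \<theta> i))" for i
  define Us where "Us = map U [0..<M]"
  have U0: "U0 \<in> carrier_mat m d" and UM: "UM \<in> carrier_mat d n"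
    by (auto simp: U0_def UM_def)
  have nth: "Us ! i = U i" if "i < M" for i using that by (simp add: Us_def)

  \<comment> \<open>Backward induction from the last factor: multiplying by a diagonal factor adds
    its exponent. The bound \<open>1 \<le> i\<close> excludes the differently shaped first
    factor.\<close>
  have drop: "mat_list_prod (drop i Us) = mat d n (\<lambda>(j, b). \<sigma> j powr (\<Sum>t\<in>{i..<M}. \<theta> t) * V $$ (b, j))"
    if "i \<le> M - 1" "1 \<le> i" for i
    using that
  proof (induction i rule: inc_induct)
    case base
    have "drop (M - 1) Us = [U (M - 1)]"
      using \<open>2 \<le> M\<close> Cons_nth_drop_Suc[of "M - 1" Us] by (simp add: Us_def)
    moreover have "{M - 1..<M} = {M - 1}" using \<open>2 \<le> M\<close> by auto
    ultimately show ?case using \<open>2 \<le> M\<close> by (simp add: U_def UM_def)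
  next
    case (step i)
    let ?R = "mat d n (\<lambda>(j, b). \<sigma> j powr (\<Sum>t\<in>{Suc i..<M}. \<theta> t) * V $$ (b, j))"
    have "drop i Us = U i # drop (Suc i) Us"
      using step.hyps Cons_nth_drop_Suc[of i Us] by (simp add: Us_def)
    moreover have "drop (Suc i) Us \<noteq> []" using step.hyps by (simp add: Us_def)
    ultimately have "mat_list_prod (drop i Us) = U i * mat_list_prod (drop (Suc i) Us)"
      by (simp add: mat_list_prod_Cons)
    also have "mat_list_prod (drop (Suc i) Us) = ?R" using step.IH step.prems by simp
    also have "U i = mat_diag d (\<lambda>j. \<sigma> j powr \<theta> i)" using step by (simp add: U_def)
    also have "mat_diag d (\<lambda>j. \<sigma> j powr \<theta> i) * ?R
        = mat d n (\<lambda>(j, b). \<sigma> j powr (\<theta> i + (\<Sum>t\<in>{Suc i..<M}. \<theta> t)) * V $$ (b, j))"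
      by (subst mat_diag_mult_left[of _ d n]) (auto simp: powr_add intro!: eq_matI)
    also have "\<theta> i + (\<Sum>t\<in>{Suc i..<M}. \<theta> t) = (\<Sum>t\<in>{i..<M}. \<theta> t)"
      using step.hyps by (simp add: sum.atLeast_Suc_lessThan)
    finally show ?case .
  qed
  have "mat_list_prod Us = U0 * mat_list_prod (drop 1 Us)"
    using \<open>2 \<le> M\<close> mat_list_prod_Cons[of "drop 1 Us" U0] Cons_nth_drop_Suc[of 0 Us]
    by (simp add: Us_def U_def)
  also have "mat_list_prod (drop 1 Us) = mat d n (\<lambda>(j, b). \<sigma> j powr (1 - \<theta> 0) * V $$ (b, j))"
  proof -
    have "(\<Sum>t\<in>{1..<M}. \<theta> t) = 1 - \<theta> 0"
      using \<theta>_sum \<open>2 \<le> M\<close> by (simp add: lessThan_atLeast0 sum.atLeast_Suc_lessThan)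
    then show ?thesis using drop[of 1] \<open>2 \<le> M\<close> by simp
  qed
  also have "U0 * \<dots> = X"
  proof (rule eq_matI)
    fix a b assume "a < dim_row X" "b < dim_col X"
    then have ab: "a < m" "b < n" using X by auto
    have "(U0 * mat d n (\<lambda>(j, b). \<sigma> j powr (1 - \<theta> 0) * V $$ (b, j))) $$ (a, b)
        = (\<Sum>j<d. (X * V) $$ (a, j) * (\<sigma> j powr (\<theta> 0 - 1) * \<sigma> j powr (1 - \<theta> 0)) * V $$ (b, j))"
      using ab by (simp add: U0_def scalar_prod_def lessThan_atLeast0 ac_simps)
    \<comment> \<open>The exponents \<open>\<theta> 0 - 1\<close> and \<open>1 - \<theta> 0\<close>
      cancel, and \<open>\<sigma> j powr 0\<close> is 1 or, for \<open>\<sigma> j = 0\<close>,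
      0.\<close>
    also have "\<dots> = (\<Sum>j<d. (if \<sigma> j = 0 then 0 else (X * V) $$ (a, j) * V $$ (b, j)))"
      by (intro sum.cong refl) (auto simp: powr_add[symmetric])
    \<comment> \<open>The range changes from \<open>d\<close> to \<open>n\<close> without loss:
      beyond either bound \<open>\<sigma> j = 0\<close>, and for \<open>j < n\<close> column
      \<open>j\<close> of \<open>X * V\<close> is then zero by \<open>XV0\<close>.\<close>
    also have "\<dots> = (\<Sum>j<n. (X * V) $$ (a, j) * V $$ (b, j))"
      by (rule sum.mono_neutral_cong) (use \<sigma>d \<sigma>n XV0 ab in auto)
    also have "\<dots> = (X * V * transpose_mat V) $$ (a, b)"
      by (rule mult_transpose_index[OF XV V(1) ab, symmetric])
    also have "X * V * transpose_mat V = X"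
      using X V orthogonal_mat_inverse[OF V] by (simp add: assoc_mult_mat[of _ m n _ n _ n])
    finally show "(U0 * mat d n (\<lambda>(j, b). \<sigma> j powr (1 - \<theta> 0) * V $$ (b, j))) $$ (a, b) = X $$ (a, b)" .
  qed (use X U0 in auto)
  finally have "factorization m n d M X Us"
    unfolding factorization_def using \<open>2 \<le> M\<close> U0 UM
    by (auto simp: nth U_def) (simp add: Us_def)
  moreover have "schatten q (Us ! i) = (\<Sum>j<d. (sv X j powr \<theta> i) powr q) powr (1 / q)" if "i < M" for i q
  proof -
    \<comment> \<open>Every factor has a Gram matrix that is this \<open>d\<close> by
      \<open>d\<close> diagonal matrix: the column Gram matrix for the first and middle factors, the
      row Gram matrix for the last.\<close>
    have diag: "schatten q A = (\<Sum>j<d. (sv X j powr \<theta> i) powr q) powr (1 / q)"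
      if "A \<in> carrier_mat a b"
        and "transpose_mat A * A = mat_diag d (\<lambda>j. (\<sigma> j powr \<theta> i)\<^sup>2)
          \<or> A * transpose_mat A = mat_diag d (\<lambda>j. (\<sigma> j powr \<theta> i)\<^sup>2)" for A a b
      using that(2) schatten_eq_proots_col_gram[OF that(1), of q] schatten_eq_proots_row_gram[OF that(1), of q]
        sum_proots_char_poly_diag_squares[of "\<lambda>j. \<sigma> j powr \<theta> i" q d]
      by (auto simp: \<sigma>_def)
    consider "i = 0" | "i = M - 1" "i \<noteq> 0" | "i \<noteq> 0" "i \<noteq> M - 1" by blast
    then have "schatten q (U i) = (\<Sum>j<d. (sv X j powr \<theta> i) powr q) powr (1 / q)"
    proof cases
      case 1
      have "transpose_mat U0 * U0 = mat_diag d (\<lambda>j. (\<sigma> j powr \<theta> 0)\<^sup>2)"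
      proof (rule eq_matI)
        fix s t assume "s < dim_row (mat_diag d (\<lambda>j. (\<sigma> j powr \<theta> 0)\<^sup>2))" "t < dim_col (mat_diag d (\<lambda>j. (\<sigma> j powr \<theta> 0)\<^sup>2))"
        then have st: "s < d" "t < d" by (auto simp: mat_diag_def)
        have "(transpose_mat U0 * U0) $$ (s, t)
            = \<sigma> s powr (\<theta> 0 - 1) * \<sigma> t powr (\<theta> 0 - 1) * (\<Sum>a<m. (X * V) $$ (a, s) * (X * V) $$ (a, t))"
          using st unfolding sum_distrib_left
          by (simp add: U0_def scalar_prod_def lessThan_atLeast0 ac_simps)
        \<comment> \<open>If one of the singular values is zero, both sides vanish; otherwise
          \<open>s\<close> and \<open>t\<close> are below \<open>n\<close> and the orthogonality of
          the columns of \<open>X * V\<close> applies.\<close>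
        also have "\<dots> = (if s = t then (\<sigma> t powr \<theta> 0)\<^sup>2 else 0)"
        proof (cases "\<sigma> s = 0 \<or> \<sigma> t = 0")
          case False
          then have "s < n" "t < n" using \<sigma>n by (meson not_le)+
          moreover have "0 < \<sigma> t" using False \<sigma>0[of t] by simp
          ultimately show ?thesis
            by (auto simp: XV_gram powr_diff power2_eq_square)
        qed auto
        also have "\<dots> = mat_diag d (\<lambda>j. (\<sigma> j powr \<theta> 0)\<^sup>2) $$ (s, t)" using st by (simp add: mat_diag_def)
        finally show "(transpose_mat U0 * U0) $$ (s, t) = mat_diag d (\<lambda>j. (\<sigma> j powr \<theta> 0)\<^sup>2) $$ (s, t)" .
      qed (auto simp: mat_diag_def U0_def)
      then show ?thesis using diag[OF U0] 1 by (simp add: U_def)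
    next
      case 2
      have "UM * transpose_mat UM = mat_diag d (\<lambda>j. (\<sigma> j powr \<theta> (M - 1))\<^sup>2)"
      proof (rule eq_matI)
        fix s t assume "s < dim_row (mat_diag d (\<lambda>j. (\<sigma> j powr \<theta> (M - 1))\<^sup>2))" "t < dim_col (mat_diag d (\<lambda>j. (\<sigma> j powr \<theta> (M - 1))\<^sup>2))"
        then have st: "s < d" "t < d" by (auto simp: mat_diag_def)
        have "(UM * transpose_mat UM) $$ (s, t)
            = \<sigma> s powr \<theta> (M - 1) * \<sigma> t powr \<theta> (M - 1) * (\<Sum>b<n. V $$ (b, s) * V $$ (b, t))"
          using st unfolding sum_distrib_left
          by (simp add: UM_def scalar_prod_def lessThan_atLeast0 ac_simps)
        also have "\<dots> = (if s = t then (\<sigma> t powr \<theta> (M - 1))\<^sup>2 else 0)"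
        proof (cases "\<sigma> s = 0 \<or> \<sigma> t = 0")
          case False
          then have "s < n" "t < n" using \<sigma>n by (meson not_le)+
          then show ?thesis
            by (auto simp: orthogonal_mat_index[OF V] power2_eq_square)
        qed auto
        also have "\<dots> = mat_diag d (\<lambda>j. (\<sigma> j powr \<theta> (M - 1))\<^sup>2) $$ (s, t)" using st by (simp add: mat_diag_def)
        finally show "(UM * transpose_mat UM) $$ (s, t) = mat_diag d (\<lambda>j. (\<sigma> j powr \<theta> (M - 1))\<^sup>2) $$ (s, t)" .
      qed (auto simp: mat_diag_def UM_def)
      then show ?thesis using diag[OF UM] 2 by (simp add: U_def)
    next
      case 3
      let ?D = "mat_diag d (\<lambda>j. \<sigma> j powr \<theta> i)"
      have "transpose_mat ?D = ?D" by (rule eq_matI) (auto simp: mat_diag_def)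
      then have "transpose_mat ?D * ?D = mat_diag d (\<lambda>j. (\<sigma> j powr \<theta> i)\<^sup>2)"
        by (simp add: power2_eq_square)
      then show ?thesis using diag[OF mat_diag_dim] 3 by (simp add: U_def)
    qed
    then show ?thesis using nth[OF that] by simp
  qed
  ultimately show ?thesis using that by blast
qed

theorem theorem5:
  fixes m n d r M :: nat and X :: "real mat" and p :: real and ps :: "nat \<Rightarrow> real"
  assumes "X \<in> carrier_mat m n"
    and "vec_space.rank m X = r" and "r \<le> d"
    and "M \<ge> 2"
    and "0 < p" and "p \<le> 1"
    and "\<forall>i<M. 0 < ps i"
    and "(\<Sum>i<M. 1 / ps i) = 1 / p"
  shows "(\<exists>Us. factorization m n d M X Us \<and>
            schatten p X = (\<Prod>i<M. schatten (ps i) (Us ! i)))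
       \<and> (\<forall>Us. factorization m n d M X Us \<longrightarrow>
            schatten p X \<le> (\<Prod>i<M. schatten (ps i) (Us ! i)))
       \<and> (\<exists>Us. factorization m n d M X Us \<and>
            schatten p X = ((\<Sum>i<M. schatten (ps i) (Us ! i) powr ps i / ps i) / (1 / p)) powr (1 / p))
       \<and> (\<forall>Us. factorization m n d M X Us \<longrightarrow>
            schatten p X \<le> ((\<Sum>i<M. schatten (ps i) (Us ! i) powr ps i / ps i) / (1 / p)) powr (1 / p))"
proof -
  note X = assms(1) and ps = assms(7) and sum = assms(8)
  define T where "T = (\<Sum>j<d. sv X j powr p)"
  have T0: "0 \<le> T" by (simp add: T_def sum_nonneg)
  have "(\<Sum>i<M. p / ps i) = 1"
    using arg_cong[OF sum, of "\<lambda>x. p * x"] \<open>0 < p\<close> by (simp add: sum_distrib_left)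
  then obtain Us where fac: "factorization m n d M X Us"
    and schatten_Us: "\<And>i q. i < M \<Longrightarrow> schatten q (Us ! i) = (\<Sum>j<d. (sv X j powr (p / ps i)) powr q) powr (1 / q)"
    using balanced_factorization_exists[OF X, of d M "\<lambda>i. p / ps i"] assms(2-4) by blast
  \<comment> \<open>The balance: \<open>(\<sigma> powr (p / ps i)) powr ps i\<close> is
    \<open>\<sigma> powr p\<close>, so every factor has the same sum \<open>T\<close>. This is the
    equality case of Hoelder and AM-GM, and one factorization attains both minima.\<close>
  have S: "schatten (ps i) (Us ! i) = T powr (1 / ps i)" if "i < M" for i
    using that ps unfolding schatten_Us[OF that] T_def by (simp add: powr_powr less_imp_neq[symmetric])
  have "sv X j = 0" if "d \<le> j" for j
    using that sv_nonzero_imp_less_rank[OF X, of j] assms(2,3) by linarith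
  then have "(\<Sum>j<max n d. sv X j powr p) = T"
    unfolding T_def by (intro sum.mono_neutral_right) auto
  then have SX: "schatten p X = T powr (1 / p)"
    using schatten_eq_sv[OF X, of "max n d" p] by simp
  have "(\<Prod>i<M. schatten (ps i) (Us ! i)) = (\<Prod>i<M. T powr (1 / ps i))" by (simp add: S)
  also have "\<dots> = T powr (1 / p)"
  \<comment> \<open>Adding exponents requires a nonzero base. For \<open>T = 0\<close> both sides
    are 0, the product being nonempty by \<open>M \<ge> 2\<close>.\<close>
  proof (cases "T = 0")
    case True
    with \<open>M \<ge> 2\<close> show ?thesis by simp
  next
    case False
    then show ?thesis by (simp add: powr_sum[symmetric] sum)
  qed
  finally have prod_eq: "schatten p X = (\<Prod>i<M. schatten (ps i) (Us ! i))" using SX by simp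
  have "schatten (ps i) (Us ! i) powr ps i / ps i = T * (1 / ps i)" if "i < M" for i
    using that ps T0 by (simp add: S powr_powr less_imp_neq[symmetric])
  then have "(\<Sum>i<M. schatten (ps i) (Us ! i) powr ps i / ps i) = T * (1 / p)"
    unfolding sum[symmetric] sum_distrib_left by (intro sum.cong refl) simp
  then have "((\<Sum>i<M. schatten (ps i) (Us ! i) powr ps i / ps i) / (1 / p)) = T"
    using \<open>0 < p\<close> by simp
  then have sum_eq: "schatten p X = ((\<Sum>i<M. schatten (ps i) (Us ! i) powr ps i / ps i) / (1 / p)) powr (1 / p)"
    using SX by simp
  have prod_le: "schatten p X \<le> (\<Prod>i<M. schatten (ps i) (Us ! i))" if "factorization m n d M X Us" for Us
    by (rule schatten_factorization_le[OF assms(4,5) ps sum that])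
  have "schatten p X \<le> ((\<Sum>i<M. schatten (ps i) (Us ! i) powr ps i / ps i) / (1 / p)) powr (1 / p)"
    if "factorization m n d M X Us" for Us
    using prod_le[OF that]
      prod_le_weighted_power_mean[OF assms(5) ps sum, of "\<lambda>i. schatten (ps i) (Us ! i)"] schatten_nonneg
    by (meson order_trans)
  with fac prod_eq prod_le sum_eq show ?thesis by blast
qed

end
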